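(* There exists an absolute constant $C>1$ such that the following holds. Let $0<\lambda<1$ and let $n$ be large enough (i.e. $n\ge n_0(\lambda)$ for some $n_0(\lambda)$ depending only on $\lambda$). Let $p\in(0,1]$, let $K$ be a $p$-convex body in $\mathbb{R}^n$ and let $\|\cdot\|$ be the gauge of $K$. Then there exists a linear subspace $E$ of $\mathbb{R}^n$ with $\dim E=[\lambda n]$ such that for every $x\in E$ $$ \|x\| \;\ge\; \frac{(1-\lambda)^{1/2+1/p}}{a_p\,\tilde M_K}\,|x|, \qquad\text{where } a_p = C^{\frac{\ln(2/p)}{p}} .$$
   Context: $|\cdot|$ is a Euclidean norm on $\mathbb{R}^n$; $[x]$ denotes the integer part of $x$. A body $K\subset\mathbb{R}^n$ is a centrally symmetric compact star-body, i.e. a compact set with $tK\subset K$ for all $t\in[-1,1]$, with $0$ in its interior (so that its gauge is finite). For $p\in(0,1]$, $K$ is $p$-convex if for all $\alpha,\beta>0$ with $\alpha^p+\beta^p=1$ and all $x,y\in K$ one has $\alpha x+\beta y\in K$. The gauge of $K$ is $\|x\|=\inf\{s>0 : x\in sK\}$. $|K|$ denotes the volume of $K$, and $\tilde M_K=\frac{1}{|K|}\int_K |x|\,dx$. *)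

theory Defs
  imports "HOL-Analysis.Analysis" "HOL-Library.Function_Algebras"
begin

text \<open>
  The dimension \<open>n\<close> is quantified inside the statement, so \<open>\<real>\<^sup>n\<close> is
  the carrier of the library topology \<^const>\<open>Euclidean_space\<close>: functions
  on \<open>nat\<close> vanishing from index \<open>n\<close> on. The pointwise real vector space
  structure on functions makes the library notions \<open>subspace\<close> and \<open>dim\<close>
  available for its subsets.
\<close>

instantiation "fun" :: (type, real_vector) real_vector
begin

definition scaleR_fun_def: "scaleR c f = (\<lambda>x. c *\<^sub>R f x)"

instance
  by standard (auto simp: scaleR_fun_def fun_eq_iff algebra_simps)

end

abbreviation Rn :: "nat \<Rightarrow> (nat \<Rightarrow> real) set" where
  "Rn n \<equiv> topspace (Euclidean_space n)"

text \<open>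
  Lebesgue measure on \<open>\<real>\<^sup>n\<close>: the product measure lives on functions that are
  \<open>undefined\<close> outside \<open>{..<n}\<close> and is transported to functions that are zero
  there. On the full function type it is concentrated on \<open>Rn n\<close>.
\<close>

definition lborel_Rn :: "nat \<Rightarrow> (nat \<Rightarrow> real) measure" where
  "lborel_Rn n =
     distr (\<Pi>\<^sub>M i\<in>{..<n}. lborel) borel (\<lambda>x i. if i < n then x i else 0)"

text \<open>An arbitrary Euclidean norm on \<open>\<real>\<^sup>n\<close>, not only the one of the standard inner product.\<close>

definition inner_product_on_Rn ::
    "nat \<Rightarrow> ((nat \<Rightarrow> real) \<Rightarrow> (nat \<Rightarrow> real) \<Rightarrow> real) \<Rightarrow> bool" where
  "inner_product_on_Rn n B \<longleftrightarrow>
     (\<forall>x\<in>Rn n. \<forall>y\<in>Rn n. B x y = B y x) \<and>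
     (\<forall>x\<in>Rn n. \<forall>y\<in>Rn n. \<forall>z\<in>Rn n. B (x + y) z = B x z + B y z) \<and>
     (\<forall>c. \<forall>x\<in>Rn n. \<forall>y\<in>Rn n. B (c *\<^sub>R x) y = c * B x y) \<and>
     (\<forall>x\<in>Rn n. x \<noteq> 0 \<longrightarrow> B x x > 0)"

definition euclidean_norm_on_Rn :: "nat \<Rightarrow> ((nat \<Rightarrow> real) \<Rightarrow> real) \<Rightarrow> bool" where
  "euclidean_norm_on_Rn n N \<longleftrightarrow>
     (\<exists>B. inner_product_on_Rn n B \<and> (\<forall>x\<in>Rn n. N x = sqrt (B x x)))"

text \<open>The interior has to be taken in \<open>\<real>\<^sup>n\<close>, as it is empty in the full function space.\<close>

definition body :: "nat \<Rightarrow> (nat \<Rightarrow> real) set \<Rightarrow> bool" where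
  "body n K \<longleftrightarrow>
     compactin (Euclidean_space n) K \<and>
     (\<forall>t\<in>{-1..1}. (\<lambda>x. t *\<^sub>R x) ` K \<subseteq> K) \<and>
     0 \<in> Euclidean_space n interior_of K"

definition p_convex :: "real \<Rightarrow> 'a::real_vector set \<Rightarrow> bool" where
  "p_convex p K \<longleftrightarrow>
     (\<forall>\<alpha>>0. \<forall>\<beta>>0. \<alpha> powr p + \<beta> powr p = 1 \<longrightarrow>
        (\<forall>x\<in>K. \<forall>y\<in>K. \<alpha> *\<^sub>R x + \<beta> *\<^sub>R y \<in> K))"

definition body_gauge :: "'a::real_vector set \<Rightarrow> 'a \<Rightarrow> real" where
  "body_gauge K x = Inf {s. s > 0 \<and> x \<in> (\<lambda>y. s *\<^sub>R y) ` K}"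

definition mean_norm :: "nat \<Rightarrow> ((nat \<Rightarrow> real) \<Rightarrow> real) \<Rightarrow> (nat \<Rightarrow> real) set \<Rightarrow> real" where
  "mean_norm n N K = 1 / measure (lborel_Rn n) K * (LINT x:K|lborel_Rn n. N x)"

definition a_const :: "real \<Rightarrow> real \<Rightarrow> real" where
  "a_const C p = C powr (ln (2 / p) / p)"

end

theory Submission
  imports Defs "HOL-Probability.Probability"
begin

text \<open>
  Let \<open>A\<close> be the part of \<open>K\<close> where the Euclidean norm \<open>N\<close> is at most twice its mean \<open>M\<close>; by Markov it
  has at least half the volume of \<open>K\<close>. Put \<open>u = p (1 - lam) / 4\<close>, \<open>\<alpha> = u powr (1 / p)\<close> and
  \<open>\<beta> = (1 - u) powr (1 / p)\<close>. If \<open>x\<^sub>i\<close> are points of \<open>K\<close> at mutual distance more than \<open>r = 4 M / \<alpha>\<close>, then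
  the sets \<open>\<alpha> x\<^sub>i + \<beta> A\<close> are disjoint and lie in \<open>K\<close> by \<open>p\<close>-convexity, so there are at most
  \<open>2 \<beta>\<^sup>-\<^sup>n \<le> 2 exp m\<close> of them, where \<open>m\<close> is the codimension \<open>n - \<lfloor>lam n\<rfloor>\<close>. Hence the part of \<open>K\<close> on the sphere
  \<open>N = R\<close>, with \<open>R = 256 r / sqrt (1 - lam)\<close>, has an \<open>r\<close>-net \<open>X\<close> of that size. An \<open>m \<times> n\<close> Gaussian matrix \<open>G\<close>
  can be chosen with \<open>\<bar>G x\<bar> > R sqrt m / 32\<close> for all \<open>x\<close> in \<open>X\<close> and with operator norm at most \<open>8 sqrt n\<close>. A point of
  \<open>K\<close> in the kernel of \<open>G\<close> with \<open>N = R\<close> would be within \<open>r\<close> of some \<open>x\<close> in \<open>X\<close>, which would give \<open>\<bar>G x\<bar> \<le> 8 sqrt n r\<close>, a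
  contradiction. As \<open>K\<close> is star-shaped, \<open>N < R\<close> on the whole intersection of \<open>K\<close> with the kernel.
\<close>

subsection \<open>Linear algebra in Rn n\<close>


lemma mem_Rn: "x \<in> Rn n \<longleftrightarrow> (\<forall>i\<ge>n. x i = 0)"
  by (simp add: topspace_Euclidean_space)

lemma subspace_Rn: "subspace (Rn n)"
  by (auto simp: subspace_def mem_Rn scaleR_fun_def)

lemma sum_fun_apply: "(\<Sum>i\<in>I. f i) x = (\<Sum>i\<in>I. f i x)" for f :: "'i \<Rightarrow> 'a \<Rightarrow> 'b::comm_monoid_add"
  by (induction I rule: infinite_finite_induct) auto

definition unit_fun :: "nat \<Rightarrow> nat \<Rightarrow> real" where
  "unit_fun i j = (if j = i then 1 else 0)"

lemma Rn_expand: "x \<in> Rn n \<Longrightarrow> x = (\<Sum>i<n. x i *\<^sub>R unit_fun i)"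
  by (auto simp: fun_eq_iff sum_fun_apply scaleR_fun_def unit_fun_def mem_Rn if_distrib cong: if_cong)

lemma span_unit_fun: "span (unit_fun ` {..<n}) = Rn n"
proof
  have "unit_fun ` {..<n} \<subseteq> Rn n"
    by (auto simp: mem_Rn unit_fun_def)
  then show "span (unit_fun ` {..<n}) \<subseteq> Rn n"
    by (simp add: span_minimal subspace_Rn)
  show "Rn n \<subseteq> span (unit_fun ` {..<n})"
  proof
    fix x assume "x \<in> Rn n"
    then have "x = (\<Sum>i<n. x i *\<^sub>R unit_fun i)" by (rule Rn_expand)
    also have "\<dots> \<in> span (unit_fun ` {..<n})"
      by (intro span_sum span_scale span_base) auto
    finally show "x \<in> span (unit_fun ` {..<n})" .
  qed
qed

lemma inj_unit_fun: "inj_on unit_fun A"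
  by (auto simp: inj_on_def unit_fun_def fun_eq_iff split: if_splits)

lemma independent_unit_fun: "independent (unit_fun ` {..<n})"
proof (rule real_vector.independent_if_scalars_zero)
  fix u v assume u: "(\<Sum>v\<in>unit_fun ` {..<n}. u v *\<^sub>R v) = 0" and v: "v \<in> unit_fun ` {..<n}"
  obtain i where i: "i < n" "v = unit_fun i" using v by auto
  have "(\<Sum>j<n. u (unit_fun j) *\<^sub>R unit_fun j) i = 0"
    using u by (subst (asm) sum.reindex) (auto simp: inj_unit_fun)
  then show "u v = 0"
    using i by (simp add: sum_fun_apply scaleR_fun_def unit_fun_def if_distrib cong: if_cong)
qed simp

lemma dim_Rn: "dim (Rn n) = n"
proof -
  have "dim (span (unit_fun ` {..<n})) = card (unit_fun ` {..<n})"
    by (simp add: dim_eq_card_independent independent_unit_fun)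
  also have "\<dots> = n" by (simp add: card_image inj_unit_fun)
  finally show ?thesis by (simp add: span_unit_fun)
qed

text \<open>The kernel of \<open>h\<close> on \<open>V\<close> has dimension \<open>d\<close>, or
  \<open>Suc d\<close> if \<open>h\<close> vanishes on \<open>V\<close>; spanning only
  \<open>d\<close> of its basis vectors gives the exact dimension in both cases.\<close>

lemma exists_subspace_functional_zero:
  fixes V :: "'a::real_vector set" and h :: "'a \<Rightarrow> real"
  assumes V: "subspace V" "dim V = Suc d"
    and h: "\<And>x y. x \<in> V \<Longrightarrow> y \<in> V \<Longrightarrow> h (x + y) = h x + h y"
      "\<And>c x. x \<in> V \<Longrightarrow> h (c *\<^sub>R x) = c * h x"
  shows "\<exists>W. subspace W \<and> W \<subseteq> V \<and> dim W = d \<and> (\<forall>x\<in>W. h x = 0)"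
proof -
  define W where "W = {x \<in> V. h x = 0}"
  have W: "subspace W"
    using V h h(2)[of 0 0] by (auto simp: W_def subspace_def)
  obtain B where B: "B \<subseteq> W" "independent B" "W \<subseteq> span B" "card B = dim W"
    using basis_exists[of W] by blast
  \<comment> \<open>One vector completes the basis of the kernel: if \<open>h v\<close> is nonzero,
    subtracting \<open>(h x / h v) v\<close> moves any \<open>x\<close> of \<open>V\<close> into the
    kernel; if \<open>h\<close> vanishes on \<open>V\<close>, the vector 0 will do.\<close>
  have "\<exists>v. V \<subseteq> span (insert v B)"
  proof (cases "\<exists>v\<in>V. h v \<noteq> 0")
    case True
    then obtain v where v: "v \<in> V" "h v \<noteq> 0" by auto
    have "x \<in> span (insert v B)" if x: "x \<in> V" for x
    proof -
      have "x - (h x / h v) *\<^sub>R v \<in> W"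
        using v x h(1)[of x "(- (h x / h v)) *\<^sub>R v"] h(2)[of v "- (h x / h v)"] V(1)
        by (auto simp: W_def subspace_diff subspace_scale subspace_neg)
      then have "x - (h x / h v) *\<^sub>R v \<in> span (insert v B)"
        using B(3) span_mono[of B "insert v B"] by blast
      moreover have "(h x / h v) *\<^sub>R v \<in> span (insert v B)"
        by (intro span_scale span_base) auto
      ultimately show ?thesis
        by (metis diff_add_cancel span_add)
    qed
    then show ?thesis by blast
  next
    case False
    then have "V \<subseteq> span (insert 0 B)"
      using B(3) by (auto simp: W_def)
    then show ?thesis by blast
  qed
  then obtain v where v: "V \<subseteq> span (insert v B)" by blast
  obtain BV where BV: "BV \<subseteq> V" "independent BV" "V \<subseteq> span BV" "card BV = Suc d"
    using basis_exists[of V] V(2) by metis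
  \<comment> \<open>The type may be infinite-dimensional, so finiteness has to come from the
    positive cardinality \<open>Suc d\<close>: an infinite set has \<open>card\<close> 0.\<close>
  then have "finite BV" by (metis card.infinite nat.distinct(1))
  have "W \<subseteq> span BV" using BV by (auto simp: W_def)
  then have "finite B"
    using independent_span_bound[OF \<open>finite BV\<close> B(2)] B(1) by auto
  have "Suc d \<le> card (insert v B)"
    using independent_span_bound[of "insert v B" BV] \<open>finite B\<close> BV v by auto
  also have "\<dots> \<le> Suc (card B)" by (simp add: card_insert_le_m1 \<open>finite B\<close> card_insert_if)
  finally obtain D where D: "D \<subseteq> B" "card D = d"
    using obtain_subset_with_card_n by (metis Suc_le_mono)
  have "span D \<subseteq> W" using D B W by (metis order_trans span_minimal)
  moreover have "dim (span D) = d"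
    using D B by (metis dim_span dim_eq_card_independent independent_mono)
  ultimately show ?thesis
    by (intro exI[of _ "span D"]) (auto simp: W_def)
qed

text \<open>Each functional costs at most one dimension. Since the functionals may vanish
  identically, this also supplies a subspace of \<open>V\<close> of any dimension up to that of
  \<open>V\<close>.\<close>

lemma exists_common_kernel:
  fixes V :: "'a::real_vector set" and h :: "nat \<Rightarrow> 'a \<Rightarrow> real"
  assumes "subspace V" "dim V = d + m"
    and "\<And>j x y. h j (x + y) = h j x + h j y" "\<And>j c x. h j (c *\<^sub>R x) = c * h j x"
  shows "\<exists>W. subspace W \<and> W \<subseteq> V \<and> dim W = d \<and> (\<forall>x\<in>W. \<forall>j<m. h j x = 0)"
  using assms(1,2)
proof (induction m arbitrary: V)
  case 0
  then show ?case by auto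
next
  case (Suc m)
  then obtain U where U: "subspace U" "U \<subseteq> V" "dim U = d + m" "\<forall>x\<in>U. h m x = 0"
    using exists_subspace_functional_zero[of V "d + m" "h m"] assms(3,4) by auto
  then obtain W where "subspace W" "W \<subseteq> U" "dim W = d" "\<forall>x\<in>W. \<forall>j<m. h j x = 0"
    using Suc.IH by blast
  then show ?case
    using U by (intro exI[of _ W]) (auto simp: less_Suc_eq)
qed

text \<open>Induction by completing the square in the last coordinate, as in the Cholesky
  factorisation. An arbitrary Euclidean norm thereby becomes the length of a linear image, an
  expression that is Borel measurable on the whole function type.\<close>

lemma inner_product_sum_of_squares:
  assumes "inner_product_on_Rn n B"
  shows "\<exists>w::nat \<Rightarrow> nat \<Rightarrow> real. \<forall>x\<in>Rn n. B x x = (\<Sum>k<n. (\<Sum>i<n. w k i * x i)\<^sup>2)"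
  using assms
proof (induction n arbitrary: B)
  case 0
  have "B 0 0 = 0"
    using 0 unfolding inner_product_on_Rn_def
    by (metis mem_Rn mult_zero_left scaleR_zero_left zero_fun_apply)
  moreover have "x = 0" if "x \<in> Rn 0" for x :: "nat \<Rightarrow> real"
    using that by (auto simp: mem_Rn)
  ultimately have "B x x = 0" if "x \<in> Rn 0" for x
    using that by metis
  then show ?case by simp
next
  case (Suc n)
  note ip = Suc.prems[unfolded inner_product_on_Rn_def]
  have sym: "B x y = B y x" if "x \<in> Rn (Suc n)" "y \<in> Rn (Suc n)" for x y
    using ip[THEN conjunct1] that by blast
  have add: "B (x + y) z = B x z + B y z"
    if "x \<in> Rn (Suc n)" "y \<in> Rn (Suc n)" "z \<in> Rn (Suc n)" for x y z
    using ip[THEN conjunct2, THEN conjunct1] that by blast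
  have scale: "B (c *\<^sub>R x) y = c * B x y"
    if "x \<in> Rn (Suc n)" "y \<in> Rn (Suc n)" for x y c
    using ip[THEN conjunct2, THEN conjunct2, THEN conjunct1] that by blast
  have pos: "B x x > 0" if "x \<in> Rn (Suc n)" "x \<noteq> 0" for x
    using ip[THEN conjunct2, THEN conjunct2, THEN conjunct2] that by blast
  note sub = subspace_Rn[of "Suc n"]
  note closed = subspace_add[OF sub] subspace_scale[OF sub] subspace_diff[OF sub] subspace_0[OF sub]
  define e where "e = unit_fun n"
  have e: "e \<in> Rn (Suc n)" "e \<noteq> 0"
    by (auto simp: e_def mem_Rn unit_fun_def fun_eq_iff)
  define b where "b = B e e"
  have b: "b > 0" using pos e by (simp add: b_def)
  have le: "x \<in> Rn (Suc n)" if "x \<in> Rn n" for x using that by (auto simp: mem_Rn)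
  have sq: "B (x + t *\<^sub>R e) (x + t *\<^sub>R e) = B x x + 2 * t * B x e + t\<^sup>2 * b" if "x \<in> Rn (Suc n)" for x t
    using that e closed sym[of e x] sym[of x "x + t *\<^sub>R e"] sym[of e "x + t *\<^sub>R e"]
    by (simp add: add scale b_def power2_eq_square algebra_simps)
  \<comment> \<open>The Schur complement of the last coordinate: \<open>B' x x\<close> is the
    minimum over \<open>t\<close> of \<open>B (x + t e) (x + t e)\<close>, whence its
    positivity.\<close>
  define B' where "B' x y = B x y - B x e * B y e / b" for x y
  have "inner_product_on_Rn n B'"
    unfolding inner_product_on_Rn_def
  proof (intro conjI ballI impI allI)
    fix x y assume "x \<in> Rn n" "y \<in> Rn n"
    then show "B' x y = B' y x" using sym[OF le le, of x y] by (simp add: B'_def mult.commute)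
  next
    fix x y z assume "x \<in> Rn n" "y \<in> Rn n" "z \<in> Rn n"
    then have "x \<in> Rn (Suc n)" "y \<in> Rn (Suc n)" "z \<in> Rn (Suc n)" using le by blast+
    then show "B' (x + y) z = B' x z + B' y z"
      using e b by (simp add: B'_def add field_simps)
  next
    fix c x y assume "x \<in> Rn n" "y \<in> Rn n"
    then have "x \<in> Rn (Suc n)" "y \<in> Rn (Suc n)" using le by blast+
    then show "B' (c *\<^sub>R x) y = c * B' x y"
      using e b by (simp add: B'_def scale field_simps)
  next
    fix x assume x: "x \<in> Rn n" "x \<noteq> 0"
    then have x': "x \<in> Rn (Suc n)" using le by blast
    \<comment> \<open>The minimiser of the quadratic polynomial in \<open>sq\<close>.\<close>
    define t where "t = - B x e / b"
    have "x + t *\<^sub>R e \<noteq> 0"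
    proof
      assume 0: "x + t *\<^sub>R e = 0"
      have "(x + t *\<^sub>R e) n = t" using x by (simp add: scaleR_fun_def e_def unit_fun_def mem_Rn)
      with 0 have "t = 0" by simp
      with 0 x show False by simp
    qed
    then have "B (x + t *\<^sub>R e) (x + t *\<^sub>R e) > 0"
      using pos x' e closed by simp
    also have "B (x + t *\<^sub>R e) (x + t *\<^sub>R e) = B' x x"
      unfolding sq[OF x'] using b by (simp add: B'_def t_def power2_eq_square field_simps)
    finally show "B' x x > 0" .
  qed
  then obtain w where w: "\<And>x. x \<in> Rn n \<Longrightarrow> B' x x = (\<Sum>k<n. (\<Sum>i<n. w k i * x i)\<^sup>2)"
    using Suc.IH by blast
  \<comment> \<open>The new last row is the functional \<open>B x e / sqrt b\<close>, whose square
    is the term subtracted in \<open>B'\<close>.\<close>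
  define w' where "w' k i = (if k < n then (if i < n then w k i else 0) else B (unit_fun i) e / sqrt b)" for k i
  have "B x x = (\<Sum>k<Suc n. (\<Sum>i<Suc n. w' k i * x i)\<^sup>2)" if x: "x \<in> Rn (Suc n)" for x
  proof -
    define y where "y = x - x n *\<^sub>R e"
    have y: "y \<in> Rn n"
      using x by (auto simp: y_def mem_Rn e_def unit_fun_def scaleR_fun_def)
    then have y': "y \<in> Rn (Suc n)" using le by blast
    have xy: "x = y + x n *\<^sub>R e" by (simp add: y_def)
    have xe: "B x e = B y e + x n * b"
      using xy add[OF y' closed(2)[OF e(1)] e(1)] scale[OF e(1) e(1)] by (metis b_def)
    have lin: "B x e = (\<Sum>i<Suc n. x i * B (unit_fun i) e)"
    proof -
      have unit: "unit_fun i \<in> Rn (Suc n)" if "i < Suc n" for i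
        using that by (auto simp: mem_Rn unit_fun_def)
      have "B (\<Sum>i<k. x i *\<^sub>R unit_fun i) e = (\<Sum>i<k. x i * B (unit_fun i) e)" if "k \<le> Suc n" for k
        using that
      proof (induction k)
        case 0
        have "B 0 e = 0" using scale[of 0 e 0] closed(4) e by simp
        then show ?case by (simp only: lessThan_0 sum.empty)
      next
        case (Suc k)
        have "(\<Sum>i<k. x i *\<^sub>R unit_fun i) \<in> Rn (Suc n)"
          using Suc.prems by (intro subspace_sum[OF sub] closed unit) auto
        then have "B ((\<Sum>i<k. x i *\<^sub>R unit_fun i) + x k *\<^sub>R unit_fun k) e =
            (\<Sum>i<k. x i * B (unit_fun i) e) + x k * B (unit_fun k) e"
          using Suc add[OF _ closed(2)[OF unit] e(1), of _ k] scale[OF unit e(1), of k] by simp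
        then show ?case by (simp only: sum.lessThan_Suc)
      qed
      then show ?thesis using Rn_expand[OF x] by (metis order_refl)
    qed
    have "B x x = B y y + 2 * x n * B y e + (x n)\<^sup>2 * b"
      using sq[OF y', of "x n"] xy by simp
    also have "\<dots> = B' y y + (B x e)\<^sup>2 / b"
      unfolding xe B'_def using b by (simp add: field_simps power2_eq_square)
    also have "B' y y = (\<Sum>k<n. (\<Sum>i<n. w k i * x i)\<^sup>2)"
      unfolding w[OF y]
      by (simp add: y_def e_def unit_fun_def scaleR_fun_def cong: sum.cong_simp)
    also have "\<dots> = (\<Sum>k<n. (\<Sum>i<Suc n. w' k i * x i)\<^sup>2)"
      by (simp add: w'_def cong: sum.cong_simp)
    also have "(B x e)\<^sup>2 / b = (\<Sum>i<Suc n. w' n i * x i)\<^sup>2"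
    proof -
      have "(\<Sum>i<Suc n. w' n i * x i) = B x e / sqrt b"
        unfolding lin sum_divide_distrib by (intro sum.cong) (auto simp: w'_def)
      then show ?thesis using b by (simp add: power_divide)
    qed
    finally show ?thesis by simp
  qed
  then show ?case by blast
qed

subsection \<open>Volume and packing\<close>


text \<open>The transport map of \<open>lborel_Rn\<close>; it is used again to keep linear images
  inside \<open>Rn n\<close>.\<close>

definition zero_ext :: "nat \<Rightarrow> (nat \<Rightarrow> real) \<Rightarrow> nat \<Rightarrow> real" where
  "zero_ext n x i = (if i < n then x i else 0)"

lemma zero_ext_mem_Rn: "zero_ext n x \<in> Rn n"
  by (simp add: mem_Rn zero_ext_def)

lemma measurable_zero_ext [measurable]: "zero_ext n \<in> (\<Pi>\<^sub>M i\<in>{..<n}. lborel) \<rightarrow>\<^sub>M borel"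
proof (rule measurable_coordinatewise_then_product)
  fix i
  show "(\<lambda>x. zero_ext n x i) \<in> borel_measurable (\<Pi>\<^sub>M i\<in>{..<n}. lborel)"
    by (cases "i < n") (auto simp: zero_ext_def)
qed

lemma sets_lborel_Rn [measurable_cong, simp]: "sets (lborel_Rn n) = sets borel"
  and space_lborel_Rn [simp]: "space (lborel_Rn n) = UNIV"
  by (simp_all add: lborel_Rn_def)

lemma lborel_Rn_eq_distr: "lborel_Rn n = distr (\<Pi>\<^sub>M i\<in>{..<n}. lborel) borel (zero_ext n)"
  by (simp add: lborel_Rn_def zero_ext_def[abs_def])

interpretation lborel_product: product_sigma_finite "\<lambda>i::nat. lborel :: real measure" ..

section \<open>Affine changes of variables in Lebesgue measure\<close>

lemma affine_vimage_borel: "A \<in> sets borel \<Longrightarrow> (\<lambda>x::real. t + c * x) -` A \<in> sets borel"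
  using measurable_sets[of "\<lambda>x. t + c * x" borel borel A] by simp

lemma emeasure_lborel_affine:
  fixes t c :: real
  assumes "A \<in> sets borel" "c > 0"
  shows "emeasure lborel A = ennreal c * emeasure lborel ((\<lambda>x. t + c * x) -` A)"
proof -
  have [measurable]: "A \<in> sets borel" by fact
  have "emeasure lborel A = (\<integral>\<^sup>+x. indicator A x \<partial>lborel)" by simp
  also have "\<dots> = c * (\<integral>\<^sup>+x. indicator A (t + c * x) \<partial>lborel)"
    using assms by (subst nn_integral_real_affine[of _ c t]) auto
  also have "(\<integral>\<^sup>+x. indicator A (t + c * x) \<partial>lborel) = (\<integral>\<^sup>+x. indicator ((\<lambda>x. t + c * x) -` A) x \<partial>lborel)"
    by (intro nn_integral_cong) (auto simp: indicator_def)
  also have "\<dots> = emeasure lborel ((\<lambda>x. t + c * x) -` A)"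
    using assms affine_vimage_borel by (intro nn_integral_indicator) simp
  finally show ?thesis .
qed

text \<open>A product measure is determined by its values on boxes, and there the claim factors into
  the one-dimensional change of variables.\<close>

lemma PiM_lborel_affine:
  fixes t :: "nat \<Rightarrow> real" and n :: nat
  assumes c: "c > 0"
  defines "T \<equiv> \<lambda>x. \<lambda>i\<in>{..<n}. t i + c * x i"
  shows "(\<Pi>\<^sub>M i\<in>{..<n}. lborel) =
    scale_measure (ennreal c ^ n) (distr (\<Pi>\<^sub>M i\<in>{..<n}. lborel) (\<Pi>\<^sub>M i\<in>{..<n}. lborel) T)"
    (is "?P = ?Q")
proof (rule sym, rule lborel_product.PiM_eqI)
  have T [measurable]: "T \<in> ?P \<rightarrow>\<^sub>M ?P"
    unfolding T_def by measurable
  show "sets ?Q = sets ?P" by simp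
  fix A :: "nat \<Rightarrow> real set" assume A: "\<And>i. i \<in> {..<n} \<Longrightarrow> A i \<in> sets lborel"
  have "emeasure ?Q (Pi\<^sub>E {..<n} A) = ennreal c ^ n * emeasure ?P (T -` Pi\<^sub>E {..<n} A \<inter> space ?P)"
    using A by (simp add: emeasure_distr sets_PiM_I_finite)
  also have "T -` Pi\<^sub>E {..<n} A \<inter> space ?P = (\<Pi>\<^sub>E i\<in>{..<n}. (\<lambda>x. t i + c * x) -` A i)"
    by (auto simp: T_def space_PiM PiE_iff extensional_def)
  also have "emeasure ?P \<dots> = (\<Prod>i<n. emeasure lborel ((\<lambda>x. t i + c * x) -` A i))"
  proof (rule lborel_product.emeasure_PiM)
    fix i assume "i \<in> {..<n}"
    then show "(\<lambda>x. t i + c * x) -` A i \<in> sets lborel"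
      using A affine_vimage_borel by simp
  qed simp
  also have "ennreal c ^ n * \<dots> = (\<Prod>i<n. ennreal c * emeasure lborel ((\<lambda>x. t i + c * x) -` A i))"
    by (simp add: prod.distrib)
  also have "\<dots> = (\<Prod>i<n. emeasure lborel (A i))"
    using A c by (intro prod.cong refl emeasure_lborel_affine[symmetric]) auto
  finally show "emeasure ?Q (Pi\<^sub>E {..<n} A) = (\<Prod>i<n. emeasure lborel (A i))" .
qed simp

text \<open>The shift \<open>t\<close> lies in \<open>Rn n\<close>, where the measure is
  concentrated; the affine map then commutes with \<open>zero_ext\<close>.\<close>

lemma emeasure_lborel_Rn_affine:
  assumes A: "A \<in> sets borel" and c: "c > 0" and t: "t \<in> Rn n"
  shows "emeasure (lborel_Rn n) A = ennreal c ^ n * emeasure (lborel_Rn n) ((\<lambda>x. t + c *\<^sub>R x) -` A)"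
proof -
  define T where "T = (\<lambda>x. \<lambda>i\<in>{..<n}. t i + c * x i)"
  let ?P = "\<Pi>\<^sub>M i\<in>{..<n}. lborel :: real measure"
  have T [measurable]: "T \<in> ?P \<rightarrow>\<^sub>M ?P"
    unfolding T_def by measurable
  have [measurable]: "A \<in> sets borel" by fact
  have aff: "(\<lambda>x. t + c *\<^sub>R x) \<in> borel \<rightarrow>\<^sub>M borel"
    by (rule measurable_coordinatewise_then_product) (simp add: scaleR_fun_def)
  have "emeasure (lborel_Rn n) A = emeasure ?P (zero_ext n -` A \<inter> space ?P)"
    by (simp add: lborel_Rn_eq_distr emeasure_distr)
  also have "\<dots> = ennreal c ^ n * emeasure ?P (T -` (zero_ext n -` A \<inter> space ?P) \<inter> space ?P)"
    by (subst PiM_lborel_affine[OF c, of n t, folded T_def]) (simp add: emeasure_distr)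
  also have "T -` (zero_ext n -` A \<inter> space ?P) \<inter> space ?P = zero_ext n -` ((\<lambda>x. t + c *\<^sub>R x) -` A) \<inter> space ?P"
  proof -
    have "zero_ext n (T x) = t + c *\<^sub>R zero_ext n x" for x
      using t by (auto simp: fun_eq_iff zero_ext_def T_def scaleR_fun_def mem_Rn)
    then show ?thesis using measurable_space[OF T] by auto
  qed
  also have "emeasure ?P \<dots> = emeasure (lborel_Rn n) ((\<lambda>x. t + c *\<^sub>R x) -` A)"
    using measurable_sets[OF aff A] by (simp add: lborel_Rn_eq_distr emeasure_distr)
  finally show ?thesis .
qed

lemma sets_box_Rn: "{x \<in> Rn n. \<forall>i<n. \<bar>x i\<bar> \<le> d} \<in> sets borel"
proof -
  have "{x \<in> Rn n. \<forall>i<n. \<bar>x i\<bar> \<le> d} = {x \<in> space borel. \<forall>i. (i < n \<longrightarrow> \<bar>x i\<bar> \<le> d) \<and> (n \<le> i \<longrightarrow> x i = 0)}"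
    by (auto simp: mem_Rn)
  also have "\<dots> \<in> sets borel" by measurable
  finally show ?thesis .
qed

lemma emeasure_lborel_Rn_box:
  assumes "d \<ge> 0"
  shows "emeasure (lborel_Rn n) {x \<in> Rn n. \<forall>i<n. \<bar>x i\<bar> \<le> d} = ennreal (2 * d) ^ n"
proof -
  let ?P = "\<Pi>\<^sub>M i\<in>{..<n}. lborel :: real measure"
  have "emeasure (lborel_Rn n) {x \<in> Rn n. \<forall>i<n. \<bar>x i\<bar> \<le> d} =
      emeasure ?P (zero_ext n -` {x \<in> Rn n. \<forall>i<n. \<bar>x i\<bar> \<le> d} \<inter> space ?P)"
    unfolding lborel_Rn_eq_distr by (rule emeasure_distr[OF measurable_zero_ext sets_box_Rn])
  also have "zero_ext n -` {x \<in> Rn n. \<forall>i<n. \<bar>x i\<bar> \<le> d} \<inter> space ?P = (\<Pi>\<^sub>E i\<in>{..<n}. {-d..d})"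
  proof (rule set_eqI)
    fix x
    have "zero_ext n x \<in> {x \<in> Rn n. \<forall>i<n. \<bar>x i\<bar> \<le> d} \<longleftrightarrow> (\<forall>i<n. \<bar>x i\<bar> \<le> d)"
      by (simp add: zero_ext_mem_Rn[unfolded mem_Rn] mem_Rn) (simp add: zero_ext_def)
    also have "\<dots> \<longleftrightarrow> (\<forall>i\<in>{..<n}. x i \<in> {-d..d})"
    proof -
      have "\<bar>x i\<bar> \<le> d \<longleftrightarrow> x i \<in> {-d..d}" for i by auto
      then show ?thesis by (simp only: lessThan_iff Ball_def)
    qed
    finally show "x \<in> zero_ext n -` {x \<in> Rn n. \<forall>i<n. \<bar>x i\<bar> \<le> d} \<inter> space ?P \<longleftrightarrow> x \<in> (\<Pi>\<^sub>E i\<in>{..<n}. {-d..d})"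
      by (simp only: Int_iff vimage_eq PiE_iff space_PiM space_lborel space_borel UNIV_I ball_triv simp_thms)
  qed
  also have "emeasure ?P \<dots> = (\<Prod>i<n. emeasure lborel {-d..d})"
    by (rule lborel_product.emeasure_PiM) simp_all
  also have "\<dots> = ennreal (2 * d) ^ n"
  proof -
    have "emeasure lborel {-d..d} = ennreal (d - - d)" using assms by simp
    also have "d - - d = 2 * d" by simp
    finally show ?thesis by simp
  qed
  finally show ?thesis .
qed

text \<open>Writing the copy \<open>x + c A\<close> as a preimage under the inverse affine map gives
  both its measurability and its volume.\<close>

lemma affine_vimage_iff:
  fixes x y :: "'a::real_vector"
  assumes "c \<noteq> 0"
  shows "y \<in> (\<lambda>y. - (1 / c) *\<^sub>R x + (1 / c) *\<^sub>R y) -` A \<longleftrightarrow> (\<exists>a\<in>A. y = x + c *\<^sub>R a)"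
proof
  assume "y \<in> (\<lambda>y. - (1 / c) *\<^sub>R x + (1 / c) *\<^sub>R y) -` A"
  moreover have "y = x + c *\<^sub>R (- (1 / c) *\<^sub>R x + (1 / c) *\<^sub>R y)"
    using assms by (simp add: scaleR_right_diff_distrib)
  ultimately show "\<exists>a\<in>A. y = x + c *\<^sub>R a" by blast
next
  assume "\<exists>a\<in>A. y = x + c *\<^sub>R a"
  then show "y \<in> (\<lambda>y. - (1 / c) *\<^sub>R x + (1 / c) *\<^sub>R y) -` A"
    using assms by (auto simp: scaleR_add_right)
qed
text \<open>The disjoint copies \<open>x + c A\<close> have volume \<open>c ^ n\<close> times that
  of \<open>A\<close> and lie in \<open>T\<close>, so their total volume is at most that of
  \<open>T\<close>.\<close>

lemma packing_bound:
  assumes X: "finite X" "X \<subseteq> Rn n" and c: "c > 0"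
    and A: "A \<in> sets borel" and T: "T \<in> sets borel" "emeasure (lborel_Rn n) T < \<infinity>"
    and disj: "\<And>x y a b. x \<in> X \<Longrightarrow> y \<in> X \<Longrightarrow> a \<in> A \<Longrightarrow> b \<in> A \<Longrightarrow> x + c *\<^sub>R a = y + c *\<^sub>R b \<Longrightarrow> x = y"
    and sub: "\<And>x a. x \<in> X \<Longrightarrow> a \<in> A \<Longrightarrow> x + c *\<^sub>R a \<in> T"
  shows "real (card X) * c ^ n * measure (lborel_Rn n) A \<le> measure (lborel_Rn n) T"
proof (cases "X = {}")
  case False
  let ?L = "lborel_Rn n"
  define F where "F x = (\<lambda>y. - (1 / c) *\<^sub>R x + (1 / c) *\<^sub>R y) -` A" for x :: "nat \<Rightarrow> real"
  have F_iff: "y \<in> F x \<longleftrightarrow> (\<exists>a\<in>A. y = x + c *\<^sub>R a)" for x y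
    unfolding F_def using c by (intro affine_vimage_iff) simp
  have F_sets: "F x \<in> sets ?L" for x
  proof -
    have "(\<lambda>y. - (1 / c) *\<^sub>R x + (1 / c) *\<^sub>R y) \<in> borel \<rightarrow>\<^sub>M borel"
      by (rule measurable_coordinatewise_then_product) (simp add: scaleR_fun_def)
    from measurable_sets[OF this A] show ?thesis by (simp add: F_def)
  qed
  have F_meas: "emeasure ?L (F x) = ennreal c ^ n * emeasure ?L A" if "x \<in> X" for x
  proof -
    have "emeasure ?L A = ennreal (1 / c) ^ n * emeasure ?L (F x)"
      unfolding F_def
    proof (rule emeasure_lborel_Rn_affine[OF A])
      show "- (1 / c) *\<^sub>R x \<in> Rn n"
        using X that by (intro subspace_scale[OF subspace_Rn]) blast
    qed (use c in simp)
    then have "ennreal c ^ n * emeasure ?L A = (ennreal c * ennreal (1 / c)) ^ n * emeasure ?L (F x)"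
      by (simp only: power_mult_distrib mult.assoc)
    also have "ennreal c * ennreal (1 / c) = 1"
      using c by (simp flip: ennreal_mult)
    finally show ?thesis by simp
  qed
  have "disjoint_family_on F X"
    unfolding disjoint_family_on_def
  proof (intro ballI impI equals0I)
    fix x y z assume "x \<in> X" "y \<in> X" "x \<noteq> y" "z \<in> F x \<inter> F y"
    then obtain a b where "a \<in> A" "b \<in> A" "z = x + c *\<^sub>R a" "z = y + c *\<^sub>R b"
      unfolding F_iff Int_iff by blast
    then show False
      using disj[OF \<open>x \<in> X\<close> \<open>y \<in> X\<close> \<open>a \<in> A\<close> \<open>b \<in> A\<close>] \<open>x \<noteq> y\<close> by simp
  qed
  then have "(\<Sum>x\<in>X. emeasure ?L (F x)) = emeasure ?L (\<Union>x\<in>X. F x)"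
    using X F_sets by (intro sum_emeasure) auto
  also have "\<dots> \<le> emeasure ?L T"
    using sub T by (intro emeasure_mono) (auto simp: F_iff)
  finally have le: "of_nat (card X) * (ennreal c ^ n * emeasure ?L A) \<le> emeasure ?L T"
    using F_meas by simp
  have "ennreal c ^ n \<noteq> 0" "card X \<noteq> 0"
    using c False X(1) by (simp_all add: ennreal_power)
  \<comment> \<open>\<open>measure\<close> is 0 on sets of infinite measure, so this case is
    excluded first: a copy of such an \<open>A\<close> would not fit into \<open>T\<close>.\<close>
  then have "emeasure ?L A \<noteq> \<top>"
  proof (intro notI)
    assume "emeasure ?L A = \<top>"
    moreover have "of_nat (card X) * (ennreal c ^ n * \<top>) = \<top>"
      using \<open>ennreal c ^ n \<noteq> 0\<close> \<open>card X \<noteq> 0\<close> by (simp add: ennreal_mult_eq_top_iff)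
    ultimately show False using le T(2) by (metis infinity_ennreal_def less_le_not_le top_greatest)
  qed
  then have A_eq: "emeasure ?L A = ennreal (measure ?L A)"
    by (simp add: emeasure_eq_ennreal_measure)
  have T_eq: "emeasure ?L T = ennreal (measure ?L T)"
    using T(2) by (simp add: emeasure_eq_ennreal_measure)
  have "of_nat (card X) * (ennreal c ^ n * ennreal (measure ?L A)) =
      ennreal (real (card X) * (c ^ n * measure ?L A))"
    using c by (simp add: ennreal_power ennreal_mult' flip: ennreal_of_nat_eq_real_of_nat)
  then have "ennreal (real (card X) * (c ^ n * measure ?L A)) \<le> ennreal (measure ?L T)"
    using le unfolding A_eq T_eq by (simp only:)
  then show ?thesis
    by (simp add: ennreal_le_iff mult.assoc)
next
  case True
  then show ?thesis by (simp only: card.empty of_nat_0 mult_zero_left measure_nonneg)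
qed

subsection \<open>Gaussian matrices\<close>


abbreviation std_normal :: "real measure" where
  "std_normal \<equiv> density lborel std_normal_density"

interpretation std_normal: prob_space std_normal
  by (rule prob_space_normal_density) simp

abbreviation gauss_vec :: "nat \<Rightarrow> (nat \<Rightarrow> real) measure" where
  "gauss_vec n \<equiv> \<Pi>\<^sub>M i\<in>{..<n}. std_normal"

interpretation gauss_vec: prob_space "gauss_vec n"
  by (intro prob_space_PiM std_normal.prob_space_axioms)

lemma distributed_gauss_vec_coord:
  assumes "i < n"
  shows "distributed (gauss_vec n) lborel (\<lambda>g. g i) std_normal_density"
proof -
  have "distr (gauss_vec n) std_normal (\<lambda>g. g i) = std_normal"
    using assms by (intro distr_PiM_component std_normal.prob_space_axioms) auto
  then have "distr (gauss_vec n) lborel (\<lambda>g. g i) = std_normal"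
    using distr_cong[of "gauss_vec n" "gauss_vec n" lborel std_normal "\<lambda>g. g i" "\<lambda>g. g i"] by simp
  moreover have "(\<lambda>g. g i) \<in> gauss_vec n \<rightarrow>\<^sub>M lborel"
    using measurable_component_singleton[of i "{..<n}" "\<lambda>_. std_normal"] assms
    by (simp cong: measurable_cong_sets)
  ultimately show ?thesis
    by (simp add: distributed_def)
qed

lemma indep_vars_gauss_vec:
  assumes "I \<subseteq> {..<n}" "I \<noteq> {}"
  shows "prob_space.indep_vars (gauss_vec n) (\<lambda>_. borel) (\<lambda>i g. c i * g i) I"
proof -
  have "gauss_vec.indep_vars n (\<lambda>_. std_normal) (\<lambda>i g. g i) {..<n}"
  proof (subst gauss_vec.indep_vars_iff_distr_eq_PiM')
    show "{..<n} \<noteq> {}" using assms by auto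
    show "(\<lambda>g. g i) \<in> gauss_vec n \<rightarrow>\<^sub>M std_normal" if "i \<in> {..<n}" for i
      using that by simp
    have "distr (gauss_vec n) (gauss_vec n) (\<lambda>g. \<lambda>i\<in>{..<n}. g i) = distr (gauss_vec n) (gauss_vec n) (\<lambda>g. g)"
      by (intro distr_cong) (auto simp: space_PiM)
    also have "\<dots> = gauss_vec n" by (rule distr_id)
    also have "\<dots> = (\<Pi>\<^sub>M i\<in>{..<n}. distr (gauss_vec n) std_normal (\<lambda>g. g i))"
      by (intro PiM_cong refl distr_PiM_component[symmetric] std_normal.prob_space_axioms) auto
    finally show "distr (gauss_vec n) (gauss_vec n) (\<lambda>g. \<lambda>i\<in>{..<n}. g i) =
      (\<Pi>\<^sub>M i\<in>{..<n}. distr (gauss_vec n) std_normal (\<lambda>g. g i))" .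
  qed
  then have "gauss_vec.indep_vars n (\<lambda>_. std_normal) (\<lambda>i g. g i) I"
    using assms(1) by (rule gauss_vec.indep_vars_subset)
  then show ?thesis
    by (rule gauss_vec.indep_vars_compose2) simp
qed

text \<open>Rotation invariance: the variances of independent normal variables add up, here to
  1.\<close>

lemma distributed_gauss_vec_linear:
  assumes "(\<Sum>k<n. (x k)\<^sup>2) = 1"
  shows "distributed (gauss_vec n) lborel (\<lambda>g. \<Sum>k<n. x k * g k) std_normal_density"
proof -
  \<comment> \<open>Zero coefficients are dropped, since each summand must be normal with positive
    standard deviation.\<close>
  define I where "I = {k. k < n \<and> x k \<noteq> 0}"
  have I: "I \<subseteq> {..<n}" "finite I" by (auto simp: I_def)
  have sum_I: "(\<Sum>k\<in>I. (x k)\<^sup>2) = 1"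
    unfolding assms[symmetric] by (intro sum.mono_neutral_left) (auto simp: I_def)
  then have "I \<noteq> {}" by auto
  have "distributed (gauss_vec n) lborel (\<lambda>g. \<Sum>k\<in>I. x k * g k)
      (normal_density (\<Sum>k\<in>I. 0) (sqrt (\<Sum>k\<in>I. \<bar>x k\<bar>\<^sup>2)))"
  proof (rule gauss_vec.sum_indep_normal)
    show "gauss_vec.indep_vars n (\<lambda>_. borel) (\<lambda>k g. x k * g k) I"
      using I \<open>I \<noteq> {}\<close> by (intro indep_vars_gauss_vec)
    fix k assume k: "k \<in> I"
    then show "0 < \<bar>x k\<bar>" by (simp add: I_def)
    show "distributed (gauss_vec n) lborel (\<lambda>g. x k * g k) (normal_density 0 \<bar>x k\<bar>)"
      using gauss_vec.normal_density_affine[OF distributed_gauss_vec_coord[of k n], of "x k" 0] k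
      by (simp add: I_def)
  qed (use I \<open>I \<noteq> {}\<close> in auto)
  moreover have "(\<Sum>k\<in>I. x k * g k) = (\<Sum>k<n. x k * g k)" for g
    by (intro sum.mono_neutral_left) (auto simp: I_def)
  ultimately show ?thesis
    using sum_I by simp
qed

text \<open>Tilting the standard normal density by \<open>exp (a * y\<^sup>2)\<close> gives
  \<open>s\<close> times a centred normal density of deviation \<open>s\<close>, where
  \<open>s\<^sup>2 = 1 / (1 - 2 * a)\<close>.\<close>

lemma nn_integral_exp_square_std_normal:
  assumes "a < 1 / 2"
  shows "(\<integral>\<^sup>+y. ennreal (exp (a * y\<^sup>2)) \<partial>std_normal) = ennreal (1 / sqrt (1 - 2 * a))"
proof -
  define s where "s = 1 / sqrt (1 - 2 * a)"
  have s: "s > 0" "s\<^sup>2 = 1 / (1 - 2 * a)"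
    using assms by (simp_all add: s_def power_divide)
  have eq: "std_normal_density y * exp (a * y\<^sup>2) = s * normal_density 0 s y" for y
  proof -
    have "exp (- y\<^sup>2 / 2) * exp (a * y\<^sup>2) = exp (- y\<^sup>2 / (2 * s\<^sup>2))"
      unfolding s(2) by (simp flip: exp_add) (simp add: field_simps)
    then show ?thesis
      using s(1) by (simp add: normal_density_def real_sqrt_mult field_simps)
  qed
  have "(\<integral>\<^sup>+y. ennreal (exp (a * y\<^sup>2)) \<partial>std_normal) =
      (\<integral>\<^sup>+y. ennreal (std_normal_density y) * ennreal (exp (a * y\<^sup>2)) \<partial>lborel)"
    by (rule nn_integral_density) auto
  also have "\<dots> = (\<integral>\<^sup>+y. ennreal s * ennreal (normal_density 0 s y) \<partial>lborel)"
    using s(1) by (simp add: eq flip: ennreal_mult)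
  also have "\<dots> = ennreal s * (\<integral>\<^sup>+y. ennreal (normal_density 0 s y) \<partial>lborel)"
    by (rule nn_integral_cmult) simp
  also have "(\<integral>\<^sup>+y. ennreal (normal_density 0 s y) \<partial>lborel) = 1"
    using prob_space.emeasure_space_1[OF prob_space_normal_density[OF s(1), of 0]]
    by (simp add: emeasure_density)
  finally show ?thesis by (simp add: s_def)
qed

lemma nn_integral_exp_square_gauss_vec:
  assumes "(\<Sum>k<n. (x k)\<^sup>2) = 1" "a < 1 / 2"
  shows "(\<integral>\<^sup>+g. ennreal (exp (a * (\<Sum>k<n. x k * g k)\<^sup>2)) \<partial>gauss_vec n) = ennreal (1 / sqrt (1 - 2 * a))"
proof -
  have "(\<integral>\<^sup>+g. ennreal (exp (a * (\<Sum>k<n. x k * g k)\<^sup>2)) \<partial>gauss_vec n) =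
      (\<integral>\<^sup>+y. ennreal (std_normal_density y) * ennreal (exp (a * y\<^sup>2)) \<partial>lborel)"
    by (intro distributed_nn_integral[symmetric] distributed_gauss_vec_linear assms) auto
  also have "\<dots> = (\<integral>\<^sup>+y. ennreal (exp (a * y\<^sup>2)) \<partial>std_normal)"
    by (rule nn_integral_density[symmetric]) auto
  finally show ?thesis
    using nn_integral_exp_square_std_normal[OF assms(2)] by simp
qed

section \<open>Matrices with independent Gaussian rows\<close>

abbreviation gauss_mat :: "nat \<Rightarrow> nat \<Rightarrow> (nat \<Rightarrow> nat \<Rightarrow> real) measure" where
  "gauss_mat m n \<equiv> \<Pi>\<^sub>M j\<in>{..<m}. gauss_vec n"

interpretation gauss_mat: prob_space "gauss_mat m n"
  by (intro prob_space_PiM gauss_vec.prob_space_axioms)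

lemma borel_measurable_gauss_vec_linear:
  "(\<lambda>g. \<Sum>k<n. x k * g k) \<in> borel_measurable (gauss_vec n)"
proof (intro borel_measurable_sum borel_measurable_times borel_measurable_const)
  fix k assume "k \<in> {..<n}"
  then show "(\<lambda>g. g k) \<in> borel_measurable (gauss_vec n)"
    using measurable_component_singleton[of k "{..<n}" "\<lambda>_. std_normal"]
    by (simp cong: measurable_cong_sets)
qed

lemma borel_measurable_gauss_mat_square:
  "(\<lambda>g. exp (a * (\<Sum>j<m. (\<Sum>k<n. x k * g j k)\<^sup>2))) \<in> borel_measurable (gauss_mat m n)"
proof -
  have "(\<lambda>g. \<Sum>k<n. x k * g j k) \<in> borel_measurable (gauss_mat m n)" if "j < m" for j
  proof -
    have "(\<lambda>g. g j) \<in> gauss_mat m n \<rightarrow>\<^sub>M gauss_vec n"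
      using that by (intro measurable_component_singleton) auto
    then show ?thesis
      by (rule measurable_compose[OF _ borel_measurable_gauss_vec_linear])
  qed
  then show ?thesis
    by (intro measurable_compose[OF _ borel_measurable_exp]) (auto intro!: borel_measurable_sum borel_measurable_times borel_measurable_power)
qed

text \<open>The rows are independent, so the moment is the product of \<open>m\<close> equal moments
  of a single row.\<close>

lemma nn_integral_exp_square_gauss_mat:
  assumes "(\<Sum>k<n. (x k)\<^sup>2) = 1" "a < 1 / 2"
  shows "(\<integral>\<^sup>+g. ennreal (exp (a * (\<Sum>j<m. (\<Sum>k<n. x k * g j k)\<^sup>2))) \<partial>gauss_mat m n) =
    ennreal ((1 / sqrt (1 - 2 * a)) ^ m)"
proof -
  interpret product_sigma_finite "\<lambda>j::nat. gauss_vec n" ..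
  have "(\<integral>\<^sup>+g. ennreal (exp (a * (\<Sum>j<m. (\<Sum>k<n. x k * g j k)\<^sup>2))) \<partial>gauss_mat m n) =
      (\<integral>\<^sup>+g. (\<Prod>j<m. ennreal (exp (a * (\<Sum>k<n. x k * g j k)\<^sup>2))) \<partial>gauss_mat m n)"
    by (simp add: sum_distrib_left exp_sum prod_ennreal)
  also have "\<dots> = (\<Prod>j<m. \<integral>\<^sup>+g. ennreal (exp (a * (\<Sum>k<n. x k * g k)\<^sup>2)) \<partial>gauss_vec n)"
    using borel_measurable_gauss_vec_linear
    by (intro product_nn_integral_prod) auto
  also have "\<dots> = ennreal ((1 / sqrt (1 - 2 * a)) ^ m)"
    using assms by (simp add: nn_integral_exp_square_gauss_vec ennreal_power)
  finally show ?thesis .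
qed

text \<open>
  A Chernoff bound without probabilities: the exponential moments of the two undesired deviations
  sum to less than 1 in the mean, hence at some matrix, and there every single one is below 1.
\<close>

lemma exists_matrix_small_large:
  fixes X Z :: "(nat \<Rightarrow> real) set"
  assumes X: "finite X" "\<And>x. x \<in> X \<Longrightarrow> (\<Sum>k<n. (x k)\<^sup>2) = 1" "card X \<le> 2 * exp (real m)"
    and Z: "finite Z" "\<And>z. z \<in> Z \<Longrightarrow> (\<Sum>k<n. (z k)\<^sup>2) = 1" "card Z \<le> 5 ^ n"
    and m: "1 \<le> m" "m \<le> n"
  shows "\<exists>g. (\<forall>x\<in>X. (\<Sum>j<m. (\<Sum>k<n. x k * g j k)\<^sup>2) > real m / 1024) \<and>
             (\<forall>z\<in>Z. (\<Sum>j<m. (\<Sum>k<n. z k * g j k)\<^sup>2) < 16 * real n)"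
proof -
  define Q where "Q x g = (\<Sum>j<m. (\<Sum>k<n. x k * g j k)\<^sup>2)" for x :: "nat \<Rightarrow> real" and g :: "nat \<Rightarrow> nat \<Rightarrow> real"
  \<comment> \<open>The weights turn the thresholds into 1:
    \<open>p * exp (- (1023 / 2) * Q) < 1\<close> means \<open>Q > m / 1024\<close>, and
    \<open>q * exp (1 / 4 * Q) < 1\<close> means \<open>Q < 16 * n\<close>. At these rates
    \<open>1 - 2 * a\<close> is \<open>32\<^sup>2\<close> and \<open>1 / 2\<close>.\<close>
  define p q where "p = exp (real m * (1023 / 2048))" and "q = exp (- 4 * real n)"
  define F where "F g = (\<Sum>x\<in>X. ennreal p * ennreal (exp (- (1023 / 2) * Q x g))) +
    (\<Sum>z\<in>Z. ennreal q * ennreal (exp (1 / 4 * Q z g)))" for g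
  note [measurable] = borel_measurable_gauss_mat_square[where m = m and n = n, folded Q_def]
  have "(\<integral>\<^sup>+g. F g \<partial>gauss_mat m n) =
      (\<Sum>x\<in>X. ennreal p * (\<integral>\<^sup>+g. ennreal (exp (- (1023 / 2) * Q x g)) \<partial>gauss_mat m n)) +
      (\<Sum>z\<in>Z. ennreal q * (\<integral>\<^sup>+g. ennreal (exp (1 / 4 * Q z g)) \<partial>gauss_mat m n))"
  proof -
    have sum: "(\<integral>\<^sup>+g. (\<Sum>x\<in>S. ennreal c * ennreal (exp (a * Q x g))) \<partial>gauss_mat m n) =
        (\<Sum>x\<in>S. ennreal c * (\<integral>\<^sup>+g. ennreal (exp (a * Q x g)) \<partial>gauss_mat m n))" for S c a
      by (subst nn_integral_sum, measurable) (intro sum.cong refl nn_integral_cmult, measurable)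
    show ?thesis
      unfolding F_def sum[symmetric] by (rule nn_integral_add) measurable
  qed
  also have "\<dots> = (\<Sum>x\<in>X. ennreal p * ennreal ((1 / 32) ^ m)) + (\<Sum>z\<in>Z. ennreal q * ennreal (sqrt 2 ^ m))"
  proof -
    have "(\<integral>\<^sup>+g. ennreal (exp (- (1023 / 2) * Q x g)) \<partial>gauss_mat m n) = ennreal ((1 / 32) ^ m)" if "x \<in> X" for x
    proof -
      have "sqrt (1 - 2 * (- (1023 / 2))) = 32" by (simp add: real_sqrt_unique)
      then show ?thesis
        unfolding Q_def using nn_integral_exp_square_gauss_mat[OF X(2)[OF that], of "- (1023 / 2)" m] by simp
    qed
    moreover have "(\<integral>\<^sup>+g. ennreal (exp (1 / 4 * Q z g)) \<partial>gauss_mat m n) = ennreal (sqrt 2 ^ m)" if "z \<in> Z" for z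
    proof -
      have "1 / sqrt (1 - 2 * (1 / 4)) = sqrt 2" by (simp add: real_sqrt_divide)
      then show ?thesis
        unfolding Q_def using nn_integral_exp_square_gauss_mat[OF Z(2)[OF that], of "1 / 4" m] by simp
    qed
    ultimately show ?thesis by simp
  qed
  also have "\<dots> = ennreal (real (card X) * (p * (1 / 32) ^ m) + real (card Z) * (q * sqrt 2 ^ m))"
    by (simp add: p_def q_def ennreal_of_nat_eq_real_of_nat flip: ennreal_mult ennreal_plus)
  \<comment> \<open>The two sums are at most \<open>2 * (9 / 32) ^ m\<close> and, by
    \<open>m \<le> n\<close>, \<open>(5 / 12) ^ n\<close>. As \<open>m\<close> and \<open>n\<close>
    are at least 1, the total is at most \<open>9 / 16 + 5 / 12 = 47 / 48\<close>.\<close>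
  also have "\<dots> < 1"
  proof -
    have "real (card X) * (p * (1 / 32) ^ m) \<le> 2 * (9 / 32) ^ m"
    proof -
      have "exp (1::real) * exp (1023 / 2048) \<le> 9"
      proof -
        have "exp (1::real) * exp (1023 / 2048) \<le> exp 1 * exp 1"
          by (intro mult_left_mono) auto
        also have "\<dots> \<le> 3 * 3" using exp_le by (intro mult_mono) auto
        finally show ?thesis by simp
      qed
      then have le: "(exp 1 * exp (1023 / 2048)) ^ m \<le> (9::real) ^ m"
        by (intro power_mono) auto
      have "real (card X) * (p * (1 / 32) ^ m) \<le> 2 * exp (real m) * (p * (1 / 32) ^ m)"
        using X(3) by (intro mult_right_mono) (auto simp: p_def)
      also have "\<dots> = 2 * ((exp 1 * exp (1023 / 2048)) ^ m * (1 / 32) ^ m)"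
        by (simp add: p_def power_mult_distrib flip: exp_of_nat_mult)
      also have "\<dots> \<le> 2 * (9 ^ m * (1 / 32) ^ m)"
        using le by (intro mult_left_mono mult_right_mono) auto
      finally show ?thesis by (simp add: power_divide)
    qed
    also have "\<dots> \<le> 2 * (9 / 32) ^ 1"
      using m by (intro mult_left_mono power_decreasing) auto
    finally have 1: "real (card X) * (p * (1 / 32) ^ m) \<le> 9 / 16" by simp
    have "real (card Z) * (q * sqrt 2 ^ m) \<le> 5 ^ n * (q * sqrt 2 ^ n)"
      using Z(3) m by (intro mult_mono power_increasing) (auto simp: q_def)
    also have "\<dots> = (5 * sqrt 2 * exp (- 4)) ^ n"
      by (simp add: q_def power_mult_distrib mult_ac flip: exp_of_nat_mult)
    also have "\<dots> \<le> (5 * 2 * (1 / 24)) ^ n"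
    proof -
      have "(2::real) + 1/2 \<le> exp 1" using exp_lower_Taylor_quadratic[of "1::real"] by simp
      then have "(5/2::real) ^ 4 \<le> exp 1 ^ 4" by (intro power_mono) auto
      also have "exp 1 ^ 4 = exp (4::real)" by (simp flip: exp_of_nat_mult)
      finally have "exp (- 4::real) \<le> 1 / 24" by (simp add: exp_minus field_simps power4_eq_xxxx)
      then show ?thesis by (intro power_mono mult_mono) (auto simp: sqrt2_less_2 less_imp_le)
    qed
    also have "\<dots> \<le> (5 * 2 * (1 / 24)) ^ 1"
      using m by (intro power_decreasing) auto
    finally have 2: "real (card Z) * (q * sqrt 2 ^ m) \<le> 5 / 12" by simp
    show ?thesis
      using 1 2 by (simp add: ennreal_less_one_iff)
  qed
  finally have "(\<integral>\<^sup>+g. F g \<partial>gauss_mat m n) < 1" .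
  have "\<exists>g. F g < 1"
  proof (rule ccontr)
    assume "\<nexists>g. F g < 1"
    then have "(\<integral>\<^sup>+g. 1 \<partial>gauss_mat m n) \<le> (\<integral>\<^sup>+g. F g \<partial>gauss_mat m n)"
      by (intro nn_integral_mono) (auto simp: not_less)
    then show False
      using \<open>(\<integral>\<^sup>+g. F g \<partial>gauss_mat m n) < 1\<close> by (simp add: gauss_mat.emeasure_space_1)
  qed
  then obtain g where g: "F g < 1" by blast
  have "Q x g > real m / 1024" if "x \<in> X" for x
  proof -
    have "ennreal p * ennreal (exp (- (1023 / 2) * Q x g)) \<le> F g"
      unfolding F_def using that X(1)
      by (intro add_increasing2 zero_le member_le_sum[of x X "\<lambda>x. ennreal p * ennreal (exp (- (1023 / 2) * Q x g))"])
    from le_less_trans[OF this g] have "p * exp (- (1023 / 2) * Q x g) < 1"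
      by (simp only: p_def exp_ge_zero ennreal_less_one_iff flip: ennreal_mult)
    then have "exp (real m * (1023 / 2048) + - (1023 / 2) * Q x g) < 1"
      by (simp only: p_def exp_add)
    then show ?thesis by simp
  qed
  moreover have "Q z g < 16 * real n" if "z \<in> Z" for z
  proof -
    have "ennreal q * ennreal (exp (1 / 4 * Q z g)) \<le> F g"
      unfolding F_def using that Z(1)
      by (intro add_increasing zero_le member_le_sum[of z Z "\<lambda>z. ennreal q * ennreal (exp (1 / 4 * Q z g))"])
    from le_less_trans[OF this g] have "q * exp (1 / 4 * Q z g) < 1"
      by (simp only: q_def exp_ge_zero ennreal_less_one_iff flip: ennreal_mult)
    then have "exp (- 4 * real n + 1 / 4 * Q z g) < 1"
      by (simp only: q_def exp_add)
    then show ?thesis by simp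
  qed
  ultimately show ?thesis unfolding Q_def by blast
qed

subsection \<open>Separated sets and nets\<close>


text \<open>Only seminorms: the lengths in use depend on the first \<open>n\<close> coordinates, so
  on the full function type they vanish at some nonzero points.\<close>

locale seminorm =
  fixes f :: "'a::real_vector \<Rightarrow> real"
  assumes triangle: "f (x + y) \<le> f x + f y"
    and scale: "f (c *\<^sub>R x) = \<bar>c\<bar> * f x"
begin

lemma zero: "f 0 = 0"
  using scale[of 0 0] by simp

lemma neg: "f (- x) = f x"
  using scale[of "-1" x] by simp

lemma nonneg: "f x \<ge> 0"
  using triangle[of x "- x"] by (simp add: neg zero)

lemma diff_commute: "f (x - y) = f (y - x)"
  using neg[of "x - y"] by simp

lemma diff_le: "f (x - y) \<le> f x + f y"
  using triangle[of x "- y"] by (simp add: neg)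

lemma le_diff: "f x \<le> f y + f (x - y)"
  using triangle[of y "x - y"] by simp

text \<open>A common point gives \<open>\<alpha> (x - y) = \<beta> (b - a)\<close>, whose right side
  has size at most \<open>2 * \<beta> * \<rho>\<close>.\<close>

lemma separated_translates_disjoint:
  assumes "\<alpha> > 0" "\<beta> > 0" and r: "2 * \<beta> * \<rho> \<le> \<alpha> * r"
    and "f a \<le> \<rho>" "f b \<le> \<rho>" and eq: "\<alpha> *\<^sub>R x + \<beta> *\<^sub>R a = \<alpha> *\<^sub>R y + \<beta> *\<^sub>R b"
  shows "f (x - y) \<le> r"
proof -
  have "\<alpha> *\<^sub>R (x - y) = \<beta> *\<^sub>R (b - a)"
    using eq by (simp add: scaleR_right_diff_distrib algebra_simps)
  then have "\<alpha> * f (x - y) = \<beta> * f (b - a)"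
    using scale[of \<alpha> "x - y"] scale[of \<beta> "b - a"] assms(1,2) by simp
  also have "\<dots> \<le> \<beta> * (\<rho> + \<rho>)"
    using diff_le[of b a] assms by (intro mult_left_mono) auto
  also have "\<dots> \<le> \<alpha> * r" using r by (simp add: algebra_simps)
  finally show ?thesis using assms(1) by simp
qed

end

text \<open>The cardinality bound lets a largest separated set exist; a point farther than
  \<open>r\<close> from it could be added, so it is a net.\<close>

lemma exists_maximal_separated:
  fixes d :: "'a \<Rightarrow> 'a \<Rightarrow> real"
  assumes refl: "\<And>x. d x x \<le> r" and sym: "\<And>x y. d x y = d y x"
    and bound: "\<And>X. finite X \<Longrightarrow> X \<subseteq> T \<Longrightarrow> (\<And>x y. x \<in> X \<Longrightarrow> y \<in> X \<Longrightarrow> d x y \<le> r \<Longrightarrow> x = y) \<Longrightarrow> real (card X) \<le> L"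
  shows "\<exists>X\<subseteq>T. finite X \<and> real (card X) \<le> L \<and> (\<forall>y\<in>T. \<exists>x\<in>X. d y x \<le> r)"
proof -
  define P where "P X \<longleftrightarrow> finite X \<and> X \<subseteq> T \<and> (\<forall>x\<in>X. \<forall>y\<in>X. d x y \<le> r \<longrightarrow> x = y)" for X
  have P_bound: "real (card X) \<le> L" if "P X" for X
    using that unfolding P_def by (intro bound) blast+
  have L: "card X < Suc (nat \<lfloor>L\<rfloor>)" if "P X" for X
    using P_bound[OF that] by (simp add: less_Suc_eq_le le_nat_floor)
  have "P {}" by (simp add: P_def)
  then have "\<exists>X. P X \<and> (\<forall>Y. P Y \<longrightarrow> card Y \<le> card X)"
    using L by (intro ex_has_greatest_nat[of P "{}" card]) blast+
  then obtain X where X: "P X" "\<And>Y. P Y \<Longrightarrow> card Y \<le> card X" by blast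
  have "\<exists>x\<in>X. d y x \<le> r" if y: "y \<in> T" for y
  proof (rule ccontr)
    assume far: "\<not> (\<exists>x\<in>X. d y x \<le> r)"
    then have "y \<notin> X" using refl by blast
    have "\<not> d x y \<le> r" if "x \<in> X" for x
      using far that sym[of x y] by auto
    then have "P (insert y X)"
      using X(1) y far unfolding P_def by blast
    from X(2)[OF this] show False
      using X(1) \<open>y \<notin> X\<close> by (simp add: P_def)
  qed
  moreover have "finite X" "X \<subseteq> T" using X(1) by (simp_all add: P_def)
  ultimately show ?thesis using P_bound[OF X(1)] by auto
qed

text \<open>The packing bound for the points \<open>\<alpha> x\<close>, in the form shared by the
  net of the Euclidean sphere and the net inside \<open>K\<close>.\<close>

lemma separated_card_bound:
  fixes f :: "(nat \<Rightarrow> real) \<Rightarrow> real"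
  assumes f: "seminorm f" and X: "finite X" "X \<subseteq> Rn n"
    and sep: "\<And>x y. x \<in> X \<Longrightarrow> y \<in> X \<Longrightarrow> f (x - y) \<le> r \<Longrightarrow> x = y"
    and c: "\<alpha> > 0" "\<beta> > 0" "2 * \<beta> * \<rho> \<le> \<alpha> * r"
    and A: "A \<in> sets borel" "\<And>a. a \<in> A \<Longrightarrow> f a \<le> \<rho>"
    and T: "T \<in> sets borel" "emeasure (lborel_Rn n) T < \<infinity>"
    and sub: "\<And>x a. x \<in> X \<Longrightarrow> a \<in> A \<Longrightarrow> \<alpha> *\<^sub>R x + \<beta> *\<^sub>R a \<in> T"
  shows "real (card X) * \<beta> ^ n * measure (lborel_Rn n) A \<le> measure (lborel_Rn n) T"
proof -
  interpret seminorm f by fact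
  have "real (card ((*\<^sub>R) \<alpha> ` X)) * \<beta> ^ n * measure (lborel_Rn n) A \<le> measure (lborel_Rn n) T"
  proof (rule packing_bound)
    show "(*\<^sub>R) \<alpha> ` X \<subseteq> Rn n"
      using X(2) subspace_scale[OF subspace_Rn] by blast
    fix x y a b
    assume *: "x \<in> (*\<^sub>R) \<alpha> ` X" "y \<in> (*\<^sub>R) \<alpha> ` X" "a \<in> A" "b \<in> A" "x + \<beta> *\<^sub>R a = y + \<beta> *\<^sub>R b"
    then obtain x' y' where "x = \<alpha> *\<^sub>R x'" "x' \<in> X" "y = \<alpha> *\<^sub>R y'" "y' \<in> X" by blast
    moreover from this have "f (x' - y') \<le> r"
      using separated_translates_disjoint[OF c A(2) A(2), of a b x' y'] * by simp
    ultimately show "x = y" using sep by metis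
  qed (use X c A T sub in auto)
  moreover have "card ((*\<^sub>R) \<alpha> ` X) = card X"
    using c(1) by (intro card_image) (simp add: inj_on_def)
  ultimately show ?thesis by simp
qed

section \<open>The standard Euclidean length and lengths of linear images\<close>

definition euclid :: "nat \<Rightarrow> (nat \<Rightarrow> real) \<Rightarrow> real" where
  "euclid n x = L2_set x {..<n}"

text \<open>Covers all three lengths in use: the standard one, the given Euclidean norm, and the
  length of the image under the random matrix.\<close>

lemma seminorm_L2_set_linear:
  fixes w :: "'j \<Rightarrow> nat \<Rightarrow> real"
  shows "seminorm (\<lambda>x. L2_set (\<lambda>j. \<Sum>i<n. w j i * x i) J)"
proof
  fix x y :: "nat \<Rightarrow> real" and c :: real
  have "L2_set (\<lambda>j. \<Sum>i<n. w j i * (x + y) i) J =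
      L2_set (\<lambda>j. (\<Sum>i<n. w j i * x i) + (\<Sum>i<n. w j i * y i)) J"
    by (simp add: sum.distrib distrib_left)
  also have "\<dots> \<le> L2_set (\<lambda>j. \<Sum>i<n. w j i * x i) J + L2_set (\<lambda>j. \<Sum>i<n. w j i * y i) J"
    by (rule L2_set_triangle_ineq)
  finally show "L2_set (\<lambda>j. \<Sum>i<n. w j i * (x + y) i) J \<le> \<dots>" .
  have lin: "(\<Sum>i<n. w j i * (c *\<^sub>R x) i) = c * (\<Sum>i<n. w j i * x i)" for j
    by (simp add: scaleR_fun_def sum_distrib_left mult_ac)
  show "L2_set (\<lambda>j. \<Sum>i<n. w j i * (c *\<^sub>R x) i) J = \<bar>c\<bar> * L2_set (\<lambda>j. \<Sum>i<n. w j i * x i) J"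
    unfolding lin by (simp add: L2_set_def power_mult_distrib real_sqrt_mult flip: sum_distrib_left)
qed

lemma borel_measurable_L2_set_linear:
  fixes w :: "nat \<Rightarrow> nat \<Rightarrow> real"
  shows "(\<lambda>x. L2_set (\<lambda>j. \<Sum>i<n. w j i * x i) {..<m}) \<in> borel_measurable borel"
  unfolding L2_set_def by measurable

lemma euclid_eq: "euclid n = (\<lambda>x. L2_set (\<lambda>j. \<Sum>i<n. (if i = j then 1 else 0) * x i) {..<n})"
  by (auto simp: euclid_def fun_eq_iff if_distrib[of "\<lambda>c. c * _"] cong: if_cong intro!: L2_set_cong)

lemma seminorm_euclid: "seminorm (euclid n)"
  unfolding euclid_eq by (rule seminorm_L2_set_linear)

lemma borel_measurable_euclid [measurable]: "euclid n \<in> borel_measurable borel"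
  unfolding euclid_eq by (rule borel_measurable_L2_set_linear)

lemma abs_le_euclid: "i < n \<Longrightarrow> \<bar>x i\<bar> \<le> euclid n x"
  using member_le_L2_set[of "{..<n}" i "\<lambda>i. \<bar>x i\<bar>"] by (simp add: euclid_def L2_set_def)

lemma euclid_eq_0:
  assumes "x \<in> Rn n" "euclid n x = 0"
  shows "x = 0"
proof
  fix i
  show "x i = 0 i"
    using assms by (cases "i < n") (simp_all add: euclid_def L2_set_eq_0_iff mem_Rn)
qed

lemma sets_Rn [measurable]: "Rn n \<in> sets borel"
proof -
  have "Rn n = {x \<in> space borel. \<forall>i. n \<le> i \<longrightarrow> x i = 0}"
    by (auto simp: mem_Rn)
  also have "\<dots> \<in> sets borel" by measurable
  finally show ?thesis .
qed

lemma finite_measure_bounded: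
  assumes "\<And>x i. x \<in> T \<Longrightarrow> i < n \<Longrightarrow> \<bar>x i\<bar> \<le> b" "T \<subseteq> Rn n" "b \<ge> 0"
  shows "emeasure (lborel_Rn n) T < \<infinity>"
proof -
  have "emeasure (lborel_Rn n) T \<le> emeasure (lborel_Rn n) {x \<in> Rn n. \<forall>i<n. \<bar>x i\<bar> \<le> b}"
    using assms sets_box_Rn by (intro emeasure_mono) auto
  also have "\<dots> < \<infinity>"
    using assms by (simp add: emeasure_lborel_Rn_box ennreal_power)
  finally show ?thesis .
qed

lemma measure_pos:
  assumes "{x \<in> Rn n. \<forall>i<n. \<bar>x i\<bar> \<le> b} \<subseteq> T" "b > 0" "T \<in> sets borel" "emeasure (lborel_Rn n) T < \<infinity>"
  shows "measure (lborel_Rn n) T > 0"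
proof -
  have "0 < ennreal (2 * b) ^ n" using assms by (simp add: ennreal_power)
  also have "\<dots> = emeasure (lborel_Rn n) {x \<in> Rn n. \<forall>i<n. \<bar>x i\<bar> \<le> b}"
    using assms by (simp add: emeasure_lborel_Rn_box)
  also have "\<dots> \<le> emeasure (lborel_Rn n) T"
    using assms by (intro emeasure_mono) auto
  finally show ?thesis
    using assms(4) by (simp add: measure_def enn2real_positive_iff)
qed

text \<open>Balls of radius 1/4 about 1/2-separated points of the sphere are disjoint and lie in the
  ball of radius 5/4; the ratio of the volumes is \<open>5 ^ n\<close>.\<close>

lemma exists_net_sphere:
  "\<exists>Z\<subseteq>{x \<in> Rn n. euclid n x = 1}. finite Z \<and> real (card Z) \<le> 5 ^ n \<and>
     (\<forall>x\<in>{x \<in> Rn n. euclid n x = 1}. \<exists>z\<in>Z. euclid n (x - z) \<le> 1 / 2)"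
proof (rule exists_maximal_separated)
  interpret seminorm "euclid n" by (rule seminorm_euclid)
  show "euclid n (x - x) \<le> 1 / 2" for x :: "nat \<Rightarrow> real"
    by (simp only: diff_self zero)
  show "euclid n (x - y) = euclid n (y - x)" for x y :: "nat \<Rightarrow> real"
    by (rule diff_commute)
  define D where "D \<rho> = {x \<in> Rn n. euclid n x \<le> \<rho>}" for \<rho>
  have sets: "D \<rho> \<in> sets borel" for \<rho>
  proof -
    have "D \<rho> = Rn n \<inter> {x \<in> space borel. euclid n x \<le> \<rho>}" by (auto simp: D_def)
    also have "\<dots> \<in> sets borel" by measurable
    finally show ?thesis .
  qed
  have fin: "emeasure (lborel_Rn n) (D \<rho>) < \<infinity>" if "\<rho> \<ge> 0" for \<rho>
  proof (rule finite_measure_bounded)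
    fix x i assume "x \<in> D \<rho>" "i < n"
    then show "\<bar>x i\<bar> \<le> \<rho>" using abs_le_euclid[of i n x] by (simp add: D_def)
  next
    show "D \<rho> \<subseteq> Rn n" unfolding D_def by blast
  qed (rule that)
  \<comment> \<open>The unit ball contains the box of half-width \<open>1 / (n + 1)\<close>; the
    added 1 keeps this width positive for \<open>n = 0\<close>.\<close>
  have pos: "measure (lborel_Rn n) (D 1) > 0"
  proof (rule measure_pos[of _ "1 / (real n + 1)"])
    show "{x \<in> Rn n. \<forall>i<n. \<bar>x i\<bar> \<le> 1 / (real n + 1)} \<subseteq> D 1"
    proof
      fix x assume x: "x \<in> {x \<in> Rn n. \<forall>i<n. \<bar>x i\<bar> \<le> 1 / (real n + 1)}"
      have "euclid n x \<le> (\<Sum>i<n. \<bar>x i\<bar>)"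
        unfolding euclid_def by (rule L2_set_le_sum_abs)
      also have "\<dots> \<le> (\<Sum>i<n. 1 / (real n + 1))"
        using x by (intro sum_mono) auto
      also have "\<dots> \<le> 1" by (simp add: field_simps)
      finally show "x \<in> D 1" using x by (simp add: D_def)
    qed
  qed (use sets fin in auto)
  have scaling: "measure (lborel_Rn n) (D (5 / 4)) = (5 / 4) ^ n * measure (lborel_Rn n) (D 1)"
  proof -
    have "(\<lambda>x. 0 + (5 / 4) *\<^sub>R x) -` D (5 / 4) = D 1"
    proof (rule set_eqI)
      fix x :: "nat \<Rightarrow> real"
      have "(5 / 4) *\<^sub>R x \<in> Rn n \<longleftrightarrow> x \<in> Rn n"
        by (simp add: mem_Rn scaleR_fun_def)
      moreover have "euclid n ((5 / 4) *\<^sub>R x) \<le> 5 / 4 \<longleftrightarrow> euclid n x \<le> 1"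
        by (simp add: scale)
      ultimately show "x \<in> (\<lambda>x. 0 + (5 / 4) *\<^sub>R x) -` D (5 / 4) \<longleftrightarrow> x \<in> D 1"
        by (simp only: D_def vimage_eq mem_Collect_eq add_0)
    qed
    then have "emeasure (lborel_Rn n) (D (5 / 4)) = ennreal (5 / 4) ^ n * emeasure (lborel_Rn n) (D 1)"
      using emeasure_lborel_Rn_affine[OF sets, of "5 / 4" 0 n "5 / 4"] subspace_0[OF subspace_Rn] by simp
    then show ?thesis
      by (simp add: measure_def enn2real_mult ennreal_power)
  qed
  fix X assume X: "finite X" "X \<subseteq> {x \<in> Rn n. euclid n x = 1}"
    "\<And>x y. x \<in> X \<Longrightarrow> y \<in> X \<Longrightarrow> euclid n (x - y) \<le> 1 / 2 \<Longrightarrow> x = y"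
  have "real (card X) * (1 / 4) ^ n * measure (lborel_Rn n) (D 1) \<le> measure (lborel_Rn n) (D (5 / 4))"
  proof (rule separated_card_bound[OF seminorm_euclid, where \<alpha> = 1 and r = "1 / 2" and \<rho> = 1])
    fix x a assume "x \<in> X" "a \<in> D 1"
    then have "x \<in> Rn n" "euclid n x = 1" "a \<in> Rn n" "euclid n a \<le> 1"
      using X(2) by (auto simp: D_def)
    then show "1 *\<^sub>R x + (1 / 4) *\<^sub>R a \<in> D (5 / 4)"
      using triangle[of "1 *\<^sub>R x" "(1 / 4) *\<^sub>R a"]
      by (auto simp: D_def scale intro!: subspace_add subspace_scale subspace_Rn)
  next
    show "X \<subseteq> Rn n" using X(2) by blast
    show "emeasure (lborel_Rn n) (D (5 / 4)) < \<infinity>" by (rule fin) simp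
    show "euclid n a \<le> 1" if "a \<in> D 1" for a using that by (simp add: D_def)
  qed (use X sets in simp_all)
  then have "real (card X) * (1 / 4) ^ n \<le> (5 / 4) ^ n"
    unfolding scaling using pos by (simp only: mult_le_cancel_right_pos)
  then show "real (card X) \<le> 5 ^ n"
    by (simp add: power_divide divide_le_cancel)
qed

text \<open>
  A point of the sphere is within 1/2 of the net, so that the supremum \<open>S\<close> of \<open>h\<close> over the sphere
  satisfies \<open>S \<le> b + S / 2\<close>.
\<close>

lemma seminorm_bound_from_net:
  assumes h: "seminorm h" and bdd: "\<And>x. x \<in> Rn n \<Longrightarrow> euclid n x = 1 \<Longrightarrow> h x \<le> L"
    and net: "\<forall>x\<in>{x \<in> Rn n. euclid n x = 1}. \<exists>z\<in>Z. euclid n (x - z) \<le> 1 / 2"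
    and Z: "Z \<subseteq> Rn n" "\<And>z. z \<in> Z \<Longrightarrow> h z \<le> b"
    and x: "x \<in> Rn n"
  shows "h x \<le> 2 * b * euclid n x"
proof -
  interpret h: seminorm h by fact
  interpret e: seminorm "euclid n" by (rule seminorm_euclid)
  define W where "W = {x \<in> Rn n. euclid n x = 1}"
  have normalize: "\<exists>w\<in>W. y = euclid n y *\<^sub>R w" if "y \<in> Rn n" "y \<noteq> 0" for y
  proof
    have "euclid n y \<noteq> 0" using euclid_eq_0 that by blast
    then show "y = euclid n y *\<^sub>R ((1 / euclid n y) *\<^sub>R y)" by simp
    show "(1 / euclid n y) *\<^sub>R y \<in> W"
      using \<open>euclid n y \<noteq> 0\<close> that subspace_scale[OF subspace_Rn] e.nonneg[of y] by (simp add: W_def e.scale)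
  qed
  show ?thesis
  proof (cases "W = {}")
    \<comment> \<open>The sphere is empty only for \<open>n = 0\<close>, and a supremum over it
      would be meaningless.\<close>
    case True
    then have "x = 0" using normalize x by blast
    then show ?thesis by (simp only: h.zero e.zero mult_zero_right order_refl)
  next
    case False
    define S where "S = (SUP w\<in>W. h w)"
    \<comment> \<open>The crude bound \<open>L\<close> makes the supremum a genuine one, so that
      \<open>S / 2\<close> can be absorbed afterwards.\<close>
    have bdd_above: "bdd_above (h ` W)" using bdd by (auto simp: W_def bdd_above_def)
    have le_S: "h w \<le> S" if "w \<in> W" for w
      unfolding S_def using that bdd_above by (rule cSUP_upper)
    have S: "h y \<le> S * euclid n y" if "y \<in> Rn n" for y
    proof (cases "y = 0")
      case True
      then show ?thesis by (simp only: h.zero e.zero mult_zero_right order_refl)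
    next
      case False
      then obtain w where w: "w \<in> W" "y = euclid n y *\<^sub>R w" using normalize \<open>y \<in> Rn n\<close> by blast
      have "h y = euclid n y * h w"
        using h.scale[of "euclid n y" w] w(2) e.nonneg[of y] by simp
      then show ?thesis
        using le_S[OF w(1)] e.nonneg[of y] by (simp add: mult.commute mult_right_mono)
    qed
    have "0 \<le> S" using False le_S h.nonneg by (meson all_not_in_conv order_trans)
    have "h w \<le> b + S / 2" if w: "w \<in> W" for w
    proof -
      obtain z where z: "z \<in> Z" "euclid n (w - z) \<le> 1 / 2" using net w by (auto simp: W_def)
      have "w - z \<in> Rn n" using w z Z by (auto simp: W_def intro: subspace_diff subspace_Rn)
      then have "h (w - z) \<le> S * (1 / 2)"
        using S[of "w - z"] z(2) \<open>0 \<le> S\<close> mult_left_mono[of "euclid n (w - z)" "1 / 2" S] by linarith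
      then show ?thesis using h.le_diff[of w z] Z(2)[OF z(1)] by simp
    qed
    then have "S \<le> b + S / 2" unfolding S_def using False by (intro cSUP_least) (auto simp: S_def)
    then have "S \<le> 2 * b" by simp
    then show ?thesis
      using S[OF x] e.nonneg[of x] by (meson mult_right_mono order_trans)
  qed
qed

section \<open>Bodies: measurability, inner boxes, boundedness\<close>

lemma body_subset_Rn: "body n K \<Longrightarrow> K \<subseteq> Rn n"
  unfolding body_def by (auto dest: compactin_subset_topspace)

lemma sets_body: "body n K \<Longrightarrow> K \<in> sets borel"
  unfolding body_def
  by (auto intro!: borel_closed closedin_Euclidean_imp_closed compactin_imp_closedin Hausdorff_Euclidean_space)

lemma compact_body: "body n K \<Longrightarrow> compact K"
  unfolding body_def Euclidean_space_def compactin_subtopology euclidean_product_topology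
  by (simp add: compactin_euclidean_iff)

text \<open>A neighbourhood of 0 in the product topology contains a product of intervals. Points of
  \<open>Rn n\<close> are 0 from index \<open>n\<close> on, so only finitely many radii matter and
  their minimum is positive.\<close>

lemma body_contains_box:
  assumes "body n K"
  shows "\<exists>d>0. {x \<in> Rn n. \<forall>i<n. \<bar>x i\<bar> \<le> d} \<subseteq> K"
proof -
  have "0 \<in> Euclidean_space n interior_of K" using assms by (simp add: body_def)
  then obtain U where "openin (Euclidean_space n) U" "0 \<in> U" "U \<subseteq> K"
    unfolding interior_of_def by auto
  then obtain V where V: "openin (powertop_real UNIV) V" "0 \<in> V" "V \<inter> Rn n \<subseteq> K"
    unfolding topspace_Euclidean_space unfolding Euclidean_space_def openin_subtopology by blast
  obtain Y where Y: "0 \<in> (\<Pi>\<^sub>E i\<in>UNIV. Y i)" "\<And>i. open (Y i)" "(\<Pi>\<^sub>E i\<in>UNIV. Y i) \<subseteq> V"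
    using product_topology_open_contains_basis[OF V(1,2)] by auto
  have "\<exists>e>0. \<forall>t. \<bar>t\<bar> \<le> e \<longrightarrow> t \<in> Y i" for i
  proof -
    have "0 \<in> Y i" using Y(1) by (auto simp: PiE_iff)
    then obtain e where "e > 0" "cball 0 e \<subseteq> Y i"
      using Y(2) open_contains_cball by blast
    then show ?thesis by (intro exI[of _ e]) (auto simp: subset_iff dist_real_def)
  qed
  then obtain e where e: "\<And>i. e i > 0" "\<And>i t. \<bar>t\<bar> \<le> e i \<Longrightarrow> t \<in> Y i" by metis
  \<comment> \<open>The inserted 1 covers \<open>n = 0\<close>, where there are no radii.\<close>
  define d where "d = Min (insert 1 (e ` {..<n}))"
  have "d > 0" using e(1) by (auto simp: d_def)
  moreover have "x \<in> K" if x: "x \<in> Rn n" "\<forall>i<n. \<bar>x i\<bar> \<le> d" for x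
  proof -
    have "x i \<in> Y i" for i
    proof (cases "i < n")
      case True
      then have "d \<le> e i" by (auto simp: d_def)
      then show ?thesis using x True e(2) by force
    next
      case False
      then show ?thesis using x e by (auto simp: mem_Rn less_imp_le)
    qed
    then have "x \<in> V" using Y(3) by (auto simp: PiE_iff)
    then show ?thesis using V(3) x by blast
  qed
  ultimately show ?thesis by blast
qed

lemma body_bounded:
  assumes "body n K"
  shows "\<exists>b\<ge>0. \<forall>x\<in>K. \<forall>i<n. \<bar>x i\<bar> \<le> b"
proof -
  have "\<exists>b. \<forall>x\<in>K. \<bar>x i\<bar> \<le> b" for i
  proof -
    have "compact ((\<lambda>x. x i) ` K)"
      using compact_body[OF assms] by (intro compact_continuous_image continuous_on_product_coordinates continuous_on_subset[OF continuous_on_product_coordinates]) auto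
    then have "bounded ((\<lambda>x. x i) ` K)" by (rule compact_imp_bounded)
    then show ?thesis by (auto simp: bounded_iff)
  qed
  then obtain b where b: "\<And>i x. x \<in> K \<Longrightarrow> \<bar>x i\<bar> \<le> b i" by metis
  show ?thesis
  proof (intro exI[of _ "\<Sum>i<n. \<bar>b i\<bar>"] conjI ballI allI impI)
    fix x i assume "x \<in> K" "i < n"
    then show "\<bar>x i\<bar> \<le> (\<Sum>i<n. \<bar>b i\<bar>)"
      using b[of x i] member_le_sum[of i "{..<n}" "\<lambda>i. \<bar>b i\<bar>"] by simp
  qed (simp add: sum_nonneg)
qed

subsection \<open>The random subspace\<close>


text \<open>For \<open>y\<close> in the kernel, \<open>x\<close> and \<open>x - y\<close> have
  images of equal length under the matrix. This length exceeds \<open>R sqrt m / 32\<close> and is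
  at most \<open>8 sqrt n\<close> times \<open>f (y - x)\<close>, whence the factor
  \<open>256 = 32 * 8\<close>.\<close>

lemma random_kernel_avoids:
  fixes w :: "nat \<Rightarrow> nat \<Rightarrow> real" and n :: nat and X :: "(nat \<Rightarrow> real) set"
  defines "f \<equiv> \<lambda>x. L2_set (\<lambda>k. \<Sum>i<n. w k i * x i) {..<n}"
  assumes X: "finite X" "\<And>x. x \<in> X \<Longrightarrow> f x = R" "real (card X) \<le> 2 * exp (real m)"
    and R: "R > 0" and m: "1 \<le> m" "n = d + m"
  shows "\<exists>E. subspace E \<and> E \<subseteq> Rn n \<and> dim E = d \<and>
    (\<forall>y\<in>E. \<forall>x\<in>X. R * sqrt (real m) < 256 * sqrt (real n) * f (y - x))"
proof -
  \<comment> \<open>The linear map that turns \<open>f\<close> into the standard length, cut off by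
    \<open>zero_ext\<close> so that the operator bound on \<open>Rn n\<close> applies to its
    values.\<close>
  define c where "c x = zero_ext n (\<lambda>k. \<Sum>i<n. w k i * x i)" for x
  have c_Rn: "c x \<in> Rn n" for x unfolding c_def by (rule zero_ext_mem_Rn)
  have c_apply: "c x k = (\<Sum>i<n. w k i * x i)" if "k < n" for x k
    using that by (simp add: c_def zero_ext_def)
  have c_diff: "c (x - y) = c x - c y" for x y
    by (rule ext) (simp add: c_def zero_ext_def right_diff_distrib sum_subtractf)
  have euclid_c: "euclid n (c x) = f x" for x
    unfolding euclid_def f_def by (intro L2_set_cong refl) (simp add: c_apply)
  interpret e: seminorm "euclid n" by (rule seminorm_euclid)
  obtain Z where Z: "Z \<subseteq> {x \<in> Rn n. euclid n x = 1}" "finite Z" "real (card Z) \<le> 5 ^ n"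
    and net: "\<forall>x\<in>{x \<in> Rn n. euclid n x = 1}. \<exists>z\<in>Z. euclid n (x - z) \<le> 1 / 2"
    using exists_net_sphere[of n] by blast
  define X' where "X' = (\<lambda>x. (1 / R) *\<^sub>R c x) ` X"
  have unit: "(\<Sum>k<n. (v k)\<^sup>2) = 1" if "euclid n v = 1" for v
    using that by (simp add: euclid_def L2_set_def)
  have "\<exists>g. (\<forall>x\<in>X'. (\<Sum>j<m. (\<Sum>k<n. x k * g j k)\<^sup>2) > real m / 1024) \<and>
             (\<forall>z\<in>Z. (\<Sum>j<m. (\<Sum>k<n. z k * g j k)\<^sup>2) < 16 * real n)"
  proof (rule exists_matrix_small_large)
    show "(\<Sum>k<n. (v k)\<^sup>2) = 1" if v: "v \<in> X'" for v
    proof (rule unit)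
      obtain x where "x \<in> X" "v = (1 / R) *\<^sub>R c x" using v by (auto simp: X'_def)
      then show "euclid n v = 1" using X(2)[of x] R by (simp add: e.scale euclid_c)
    qed
    show "(\<Sum>k<n. (z k)\<^sup>2) = 1" if "z \<in> Z" for z
      using that Z(1) by (intro unit) blast
    have "card X' \<le> card X" unfolding X'_def by (rule card_image_le[OF X(1)])
    then show "real (card X') \<le> 2 * exp (real m)" using X(3) by linarith
    have "real (card Z) \<le> real (5 ^ n)" using Z(3) by simp
    then show "card Z \<le> 5 ^ n" by (simp only: of_nat_le_iff)
  qed (use X Z m in \<open>simp_all add: X'_def\<close>)
  then obtain g where gX: "\<And>x. x \<in> X' \<Longrightarrow> real m / 1024 < (\<Sum>j<m. (\<Sum>k<n. x k * g j k)\<^sup>2)"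
    and gZ: "\<And>z. z \<in> Z \<Longrightarrow> (\<Sum>j<m. (\<Sum>k<n. z k * g j k)\<^sup>2) < 16 * real n" by blast
  define h where "h = (\<lambda>x. L2_set (\<lambda>j. \<Sum>k<n. g j k * x k) {..<m})"
  have h_eq: "h x = sqrt (\<Sum>j<m. (\<Sum>k<n. x k * g j k)\<^sup>2)" for x
    by (simp add: h_def L2_set_def mult.commute)
  interpret h: seminorm h unfolding h_def by (rule seminorm_L2_set_linear)
  have h_le: "h x \<le> 2 * (4 * sqrt (real n)) * euclid n x" if "x \<in> Rn n" for x
  proof (rule seminorm_bound_from_net[OF h.seminorm_axioms _ net _ _ that])
    show "Z \<subseteq> Rn n" using Z(1) by blast
    show "h z \<le> 4 * sqrt (real n)" if "z \<in> Z" for z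
    proof -
      have "h z \<le> sqrt (16 * real n)"
        unfolding h_eq using gZ[OF that] by (intro real_sqrt_le_mono) simp
      then show ?thesis by (simp add: real_sqrt_mult)
    qed
    \<comment> \<open>An a priori bound depending on the chosen matrix, good enough to make the
      supremum over the sphere finite.\<close>
    show "h x \<le> (\<Sum>j<m. \<Sum>k<n. \<bar>g j k\<bar>)" if "euclid n x = 1" for x
    proof -
      have "h x \<le> (\<Sum>j<m. \<bar>\<Sum>k<n. g j k * x k\<bar>)"
        unfolding h_def by (rule L2_set_le_sum_abs)
      also have "\<dots> \<le> (\<Sum>j<m. \<Sum>k<n. \<bar>g j k\<bar>)"
      proof (intro sum_mono order_trans[OF sum_abs])
        fix j k assume "k \<in> {..<n}"
        then have "\<bar>x k\<bar> \<le> 1" using abs_le_euclid[of k n x] that by simp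
        then show "\<bar>g j k * x k\<bar> \<le> \<bar>g j k\<bar>"
          by (simp add: abs_mult mult_left_le)
      qed
      finally show ?thesis .
    qed
  qed
  \<comment> \<open>Row \<open>j\<close> of the matrix composed with \<open>c\<close>; the common
    kernel of these \<open>m\<close> functionals contains a subspace of dimension
    \<open>d\<close>.\<close>
  define q where "q j x = (\<Sum>k<n. g j k * c x k)" for j x
  have q_add: "q j (x + y) = q j x + q j y" for j x y
    by (simp add: q_def c_apply distrib_left sum.distrib)
  have q_scale: "q j (a *\<^sub>R x) = a * q j x" for j a x
    by (simp add: q_def c_apply scaleR_fun_def sum_distrib_left mult_ac)
  have "dim (Rn n) = d + m" by (simp add: dim_Rn m)
  from exists_common_kernel[of "Rn n" d m q, OF subspace_Rn this q_add q_scale]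
  obtain E where E: "subspace E" "E \<subseteq> Rn n" "dim E = d" "\<forall>x\<in>E. \<forall>j<m. q j x = 0"
    by auto
  have "R * sqrt (real m) < 256 * sqrt (real n) * f (y - x)" if "y \<in> E" "x \<in> X" for x y
  proof -
    have "h (c y) = L2_set (\<lambda>j. q j y) {..<m}" by (simp only: h_def q_def)
    also have "\<dots> = 0" using E(4) that(1) by (intro L2_set_0') auto
    finally have hy: "h (c y) = 0" .
    have "(1 / R) *\<^sub>R c x \<in> X'" unfolding X'_def using that(2) by (rule imageI)
    then have "sqrt (real m / 1024) < h ((1 / R) *\<^sub>R c x)"
      unfolding h_eq by (intro real_sqrt_less_mono gX)
    also have "\<dots> = 1 / R * h (c x)" using R by (simp add: h.scale)
    finally have "R * sqrt (real m / 1024) < h (c x)"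
      using R by (simp add: field_simps)
    moreover have "sqrt (1024::real) = 32" by (rule real_sqrt_unique) auto
    ultimately have "R * sqrt (real m) < 32 * h (c x)"
      by (simp add: real_sqrt_divide field_simps)
    moreover have "h (c x) \<le> h (c y) + h (c x - c y)" by (rule h.le_diff)
    moreover have "h (c x - c y) = h (c (y - x))"
      unfolding c_diff by (rule h.diff_commute)
    moreover have "h (c (y - x)) \<le> 8 * sqrt (real n) * f (y - x)"
      using h_le[OF c_Rn] by (simp add: euclid_c)
    ultimately show ?thesis using hy by simp
  qed
  then show ?thesis using E by blast
qed

text \<open>Off the set in question \<open>f\<close> exceeds twice its mean, so that part carries at
  most half the volume. The bound \<open>b\<close> makes \<open>f\<close> integrable on
  \<open>K\<close>, as the integral would otherwise default to 0.\<close>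

lemma Markov_mean_norm:
  assumes K: "K \<in> sets borel" "emeasure (lborel_Rn n) K < \<infinity>" "measure (lborel_Rn n) K > 0"
    and f: "f \<in> borel_measurable borel" "\<And>x. x \<in> K \<Longrightarrow> f x \<le> b" "\<And>x. 0 \<le> f x"
    and M: "mean_norm n f K > 0"
  shows "measure (lborel_Rn n) {x \<in> K. f x \<le> 2 * mean_norm n f K} \<ge> measure (lborel_Rn n) K / 2"
proof -
  let ?L = "lborel_Rn n" and ?M = "mean_norm n f K"
  define A where "A = {x \<in> K. f x \<le> 2 * ?M}"
  have [measurable]: "K \<in> sets ?L" "f \<in> borel_measurable ?L"
    using K f by (simp_all cong: measurable_cong_sets)
  have A: "A \<in> sets ?L"
  proof -
    have "A = K \<inter> {x \<in> space ?L. f x \<le> 2 * ?M}" by (auto simp: A_def)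
    also have "\<dots> \<in> sets ?L" by measurable
    finally show ?thesis .
  qed
  have KA: "K - A \<in> sets ?L" using A by measurable
  have "integrable ?L (\<lambda>x. indicator K x * b)"
    using K by (intro integrable_mult_left integrable_real_indicator) auto
  then have int: "integrable ?L (\<lambda>x. indicator K x * f x)"
  proof (rule Bochner_Integration.integrable_bound)
    show "AE x in ?L. norm (indicator K x * f x) \<le> norm (indicator K x * b)"
    proof (intro always_eventually allI)
      fix x show "norm (indicator K x * f x) \<le> norm (indicator K x * b)"
        using f(2)[of x] f(3)[of x] by (cases "x \<in> K") auto
    qed
  qed measurable
  have fin: "emeasure ?L (K - A) < \<infinity>"
    using K(1) by (intro le_less_trans[OF emeasure_mono K(2)]) auto
  have "2 * ?M * measure ?L (K - A) = (\<integral>x. indicator (K - A) x * (2 * ?M) \<partial>?L)"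
    using KA by simp
  also have "\<dots> \<le> (\<integral>x. indicator K x * f x \<partial>?L)"
  proof (rule integral_mono[OF _ int])
    show "integrable ?L (\<lambda>x. indicator (K - A) x * (2 * ?M))"
      using KA fin by (intro integrable_mult_left integrable_real_indicator) auto
    fix x show "indicator (K - A) x * (2 * ?M) \<le> indicator K x * f x"
      using f(3)[of x] by (auto simp: A_def indicator_def)
  qed
  also have "\<dots> = ?M * measure ?L K"
    using K(3) by (simp add: mean_norm_def set_lebesgue_integral_def)
  finally have "2 * measure ?L (K - A) \<le> measure ?L K" using M by simp
  moreover have "measure ?L (K - A) = measure ?L K - measure ?L A"
    using A K(1,2) by (intro measure_Diff) (auto simp: A_def)
  ultimately show ?thesis unfolding A_def by simp
qed

text \<open>The origin of \<open>C = exp 12\<close>. With \<open>L = ln (2 / p) \<ge> ln 2\<close>,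
  the part \<open>2 * L / p\<close> of the exponent pays for the power of \<open>p / 4\<close>, as
  \<open>4 / p \<le> (2 / p)\<^sup>2\<close>, and \<open>10 * L / p \<ge> 10 * ln 2\<close> pays for
  \<open>1024 = 2 ^ 10\<close>.\<close>

lemma inverse_a_const_le:
  assumes p: "0 < p" "p \<le> 1"
  shows "1 / a_const (exp 12) p \<le> (p / 4) powr (1 / p) / 1024"
proof -
  define L where "L = ln (2 / p)"
  have L: "L \<ge> ln 2" using p by (simp add: L_def field_simps)
  then have "L > 0" using ln_gt_zero[of "2::real"] by linarith
  have a: "a_const (exp 12) p = exp (12 * L / p)"
    by (simp add: a_const_def powr_def L_def)
  have "ln (4::real) = 2 * ln 2" using ln_realpow[of "2::real" 2] by simp
  then have "ln (p / 4) = - (ln (2 / p) + ln 2)"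
    using p by (simp add: ln_div)
  then have "- (2 * L) \<le> ln (p / 4)" using L by (simp add: L_def)
  then have "- (2 * L) / p \<le> ln (p / 4) / p" using p by (intro divide_right_mono) auto
  then have 1: "exp (- (2 * L) / p) \<le> (p / 4) powr (1 / p)"
    using p by (simp add: powr_def)
  have "10 * ln 2 \<le> 10 * L / p"
  proof -
    have "L \<le> L / p" using p \<open>L > 0\<close> by (simp add: field_simps)
    then show ?thesis using L by simp
  qed
  then have "exp (10 * ln 2) \<le> exp (10 * L / p)" by simp
  moreover have "exp (10 * ln (2::real)) = 1024"
    using exp_of_nat_mult[of 10 "ln (2::real)"] by simp
  ultimately have "1024 * exp (- (12 * L) / p) \<le> exp (10 * L / p) * exp (- (12 * L) / p)"
    by (intro mult_right_mono) auto
  also have "\<dots> = exp (- (2 * L) / p)"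
    unfolding exp_add[symmetric] add_divide_distrib[symmetric] by simp
  also note 1
  finally have "1024 * exp (- (12 * L / p)) \<le> (p / 4) powr (1 / p)" by simp
  then show ?thesis
    unfolding a exp_minus by (simp add: inverse_eq_divide)
qed

text \<open>For \<open>u = p * (1 - lam) / 4 \<le> 1 / 4\<close> one has
  \<open>ln (1 - u) \<ge> - 2 * u\<close>. The factor \<open>p\<close> in \<open>u\<close> cancels
  the exponent \<open>1 / p\<close>, which leaves \<open>(1 - lam) * n / 2 \<le> m\<close>.\<close>

lemma power_lower_bound:
  assumes p: "0 < p" "p \<le> 1" and lam: "0 < lam" "lam < 1" and m: "(1 - lam) * real n \<le> real m"
  shows "exp (- real m) \<le> ((1 - p * (1 - lam) / 4) powr (1 / p)) ^ n"
proof -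
  define u where "u = p * (1 - lam) / 4"
  have "p * (1 - lam) \<le> 1 * 1" using p lam by (intro mult_mono) auto
  then have u: "0 \<le> u" "u \<le> 1 / 4" using p lam by (simp_all add: u_def)
  have "u * u \<le> u * (1 / 4)" using u by (intro mult_left_mono) auto
  then have "u\<^sup>2 \<le> u / 4" by (simp add: power2_eq_square)
  then have "- 2 * u \<le> ln (1 - u)"
    using ln_one_minus_pos_lower_bound[of u] u by linarith
  then have "real n / p * (- 2 * u) \<le> real n / p * ln (1 - u)"
    using p by (intro mult_left_mono) auto
  moreover have "real n / p * (- 2 * u) = - ((1 - lam) * real n) / 2"
    using p by (simp add: u_def)
  moreover have "0 \<le> (1 - lam) * real n" using lam by simp
  ultimately have "- real m \<le> real n / p * ln (1 - u)" using m by linarith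
  then have "exp (- real m) \<le> exp (real n * (ln (1 - u) / p))" by simp
  also have "\<dots> = ((1 - u) powr (1 / p)) ^ n"
    using u by (simp add: powr_def flip: exp_of_nat_mult)
  finally show ?thesis by (simp add: u_def)
qed

section \<open>Lower bounds for the gauge\<close>

lemma gauge_set_nonempty:
  assumes K: "body n K" and x: "x \<in> Rn n"
  shows "\<exists>s. s > 0 \<and> x \<in> (\<lambda>y. s *\<^sub>R y) ` K"
proof -
  obtain e where e: "e > 0" "{x \<in> Rn n. \<forall>i<n. \<bar>x i\<bar> \<le> e} \<subseteq> K"
    using body_contains_box[OF K] by blast
  interpret seminorm "euclid n" by (rule seminorm_euclid)
  \<comment> \<open>The summand 1 keeps \<open>s\<close> positive for \<open>x = 0\<close>.\<close>
  define s where "s = (1 + euclid n x) / e"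
  have s: "s > 0" using e nonneg[of x] by (simp add: s_def)
  have "\<bar>((1 / s) *\<^sub>R x) i\<bar> \<le> e" if "i < n" for i
  proof -
    have "\<bar>((1 / s) *\<^sub>R x) i\<bar> \<le> euclid n ((1 / s) *\<^sub>R x)" using that by (rule abs_le_euclid)
    also have "\<dots> = euclid n x / s" using s by (simp add: scale)
    also have "\<dots> \<le> e" using e nonneg[of x] by (simp add: s_def field_simps)
    finally show ?thesis .
  qed
  moreover have "(1 / s) *\<^sub>R x \<in> Rn n" using x by (intro subspace_scale[OF subspace_Rn])
  ultimately have "(1 / s) *\<^sub>R x \<in> K" using e(2) by blast
  moreover have "x = s *\<^sub>R ((1 / s) *\<^sub>R x)" using s by simp
  ultimately show ?thesis using s by blast
qed

text \<open>\<open>Inf\<close> is a true infimum only over a nonempty set, and the inner box of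
  \<open>K\<close> provides an element.\<close>

lemma body_gauge_ge:
  assumes K: "body n K" and x: "x \<in> Rn n"
    and "\<And>s y. s > 0 \<Longrightarrow> y \<in> K \<Longrightarrow> x = s *\<^sub>R y \<Longrightarrow> b \<le> s"
  shows "b \<le> body_gauge K x"
  unfolding body_gauge_def
proof (rule cInf_greatest)
  show "{s. s > 0 \<and> x \<in> (\<lambda>y. s *\<^sub>R y) ` K} \<noteq> {}"
    using gauge_set_nonempty[OF K x] by blast
  show "b \<le> s" if "s \<in> {s. s > 0 \<and> x \<in> (\<lambda>y. s *\<^sub>R y) ` K}" for s
    using that assms(3) by blast
qed

text \<open>The core of the argument. \<open>R\<close> is chosen so that
  \<open>256 * sqrt n * r \<le> R * sqrt m\<close>, which contradicts the avoidance property at a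
  net point within \<open>r\<close>.\<close>

lemma subspace_section_bounded:
  fixes w :: "nat \<Rightarrow> nat \<Rightarrow> real" and n :: nat
  defines "f \<equiv> \<lambda>x. L2_set (\<lambda>k. \<Sum>i<n. w k i * x i) {..<n}"
  assumes K: "body n K" "p_convex p K" and p: "0 < p" "p \<le> 1" and lam: "0 < lam" "lam < 1"
    and M: "mean_norm n f K > 0"
    and m: "1 \<le> m" "n = d + m" "(1 - lam) * real n \<le> real m"
    and R: "R = 1024 * mean_norm n f K / ((p * (1 - lam) / 4) powr (1 / p) * sqrt (1 - lam))"
  shows "\<exists>E. subspace E \<and> E \<subseteq> Rn n \<and> dim E = d \<and> (\<forall>y\<in>E. y \<in> K \<longrightarrow> f y < R)"
proof -
  interpret seminorm f unfolding f_def by (rule seminorm_L2_set_linear)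
  let ?M = "mean_norm n f K" and ?L = "lborel_Rn n"
  define u where "u = p * (1 - lam) / 4"
  \<comment> \<open>Then \<open>\<alpha> powr p = u\<close> and
    \<open>\<beta> powr p = 1 - u\<close> sum to 1, as \<open>p\<close>-convexity demands. The small
    \<open>u\<close> keeps \<open>\<beta> ^ n\<close> above \<open>exp (- m)\<close>, at the price
    of a large \<open>r\<close>.\<close>
  define \<alpha> \<beta> where "\<alpha> = u powr (1 / p)" and "\<beta> = (1 - u) powr (1 / p)"
  have "p * (1 - lam) \<le> 1 * 1" using p lam by (intro mult_mono) auto
  then have u: "0 < u" "u \<le> 1 / 4" using p lam by (simp_all add: u_def)
  have pos: "\<alpha> > 0" "\<beta> > 0" using u by (simp_all add: \<alpha>_def \<beta>_def)
  have "\<beta> \<le> 1 powr (1 / p)" unfolding \<beta>_def using u p by (intro powr_mono2) auto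
  then have \<beta>_le: "\<beta> \<le> 1" by simp
  have sum_1: "\<alpha> powr p + \<beta> powr p = 1"
    using u p by (simp add: \<alpha>_def \<beta>_def powr_powr)
  \<comment> \<open>Overlapping copies of \<open>A\<close> have \<open>\<alpha> * f (x - y)\<close>
    at most \<open>2 * \<beta> * (2 * ?M)\<close>, which is at most \<open>\<alpha> * r\<close>
    because \<open>\<beta> \<le> 1\<close>.\<close>
  define r where "r = 4 * ?M / \<alpha>"
  have r: "r > 0" using M pos by (simp add: r_def)
  have R_eq: "R = 256 * r / sqrt (1 - lam)"
    by (simp add: R r_def \<alpha>_def u_def)
  have R_pos: "R > 0" using r lam by (simp add: R_eq)
  have K_sets: "K \<in> sets borel" using K(1) by (rule sets_body)
  obtain b where b: "b \<ge> 0" "\<forall>x\<in>K. \<forall>i<n. \<bar>x i\<bar> \<le> b" using body_bounded[OF K(1)] by blast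
  have K_Rn: "K \<subseteq> Rn n" using K(1) by (rule body_subset_Rn)
  have K_fin: "emeasure ?L K < \<infinity>"
    by (rule finite_measure_bounded[of _ _ b]) (use b K_Rn in auto)
  obtain e where e: "e > 0" "{x \<in> Rn n. \<forall>i<n. \<bar>x i\<bar> \<le> e} \<subseteq> K"
    using body_contains_box[OF K(1)] by blast
  have K_pos: "measure ?L K > 0" using measure_pos[OF e(2,1) K_sets K_fin] .
  have f_meas: "f \<in> borel_measurable borel"
    unfolding f_def by (rule borel_measurable_L2_set_linear)
  have f_bdd: "f x \<le> (\<Sum>k<n. \<Sum>i<n. \<bar>w k i\<bar> * b)" if "x \<in> K" for x
  proof -
    have "f x \<le> (\<Sum>k<n. \<bar>\<Sum>i<n. w k i * x i\<bar>)"
      unfolding f_def by (rule L2_set_le_sum_abs)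
    also have "\<dots> \<le> (\<Sum>k<n. \<Sum>i<n. \<bar>w k i\<bar> * b)"
    proof (intro sum_mono order_trans[OF sum_abs])
      fix k i assume "i \<in> {..<n}"
      then show "\<bar>w k i * x i\<bar> \<le> \<bar>w k i\<bar> * b"
        using b that by (simp add: abs_mult mult_left_mono)
    qed
    finally show ?thesis .
  qed
  define A where "A = {x \<in> K. f x \<le> 2 * ?M}"
  have A_half: "measure ?L A \<ge> measure ?L K / 2"
    unfolding A_def by (rule Markov_mean_norm[OF K_sets K_fin K_pos f_meas f_bdd nonneg M])
  have A_sets: "A \<in> sets borel"
  proof -
    note [measurable] = f_meas K_sets
    have "A = K \<inter> {x \<in> space borel. f x \<le> 2 * ?M}" by (auto simp: A_def)
    also have "\<dots> \<in> sets borel" by measurable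
    finally show ?thesis .
  qed
  \<comment> \<open>The net is taken inside the sphere, so that its own points satisfy
    \<open>f x = R\<close> and can be normalised.\<close>
  define T where "T = {x \<in> K. f x = R}"
  have "\<exists>X\<subseteq>T. finite X \<and> real (card X) \<le> 2 * exp (real m) \<and> (\<forall>y\<in>T. \<exists>x\<in>X. f (y - x) \<le> r)"
  proof (rule exists_maximal_separated)
    show "f (x - x) \<le> r" for x using r by (simp only: diff_self zero less_imp_le)
    show "f (x - y) = f (y - x)" for x y by (rule diff_commute)
    fix X assume X: "finite X" "X \<subseteq> T" "\<And>x y. x \<in> X \<Longrightarrow> y \<in> X \<Longrightarrow> f (x - y) \<le> r \<Longrightarrow> x = y"
    have "real (card X) * \<beta> ^ n * measure ?L A \<le> measure ?L K"
    proof (rule separated_card_bound[OF seminorm_axioms X(1) _ X(3) pos _ A_sets _ K_sets K_fin])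
      show "X \<subseteq> Rn n" using X(2) K_Rn by (auto simp: T_def)
      show "2 * \<beta> * (2 * ?M) \<le> \<alpha> * r" using \<beta>_le M pos by (simp add: r_def)
      show "f a \<le> 2 * ?M" if "a \<in> A" for a using that by (simp add: A_def)
      show "\<alpha> *\<^sub>R x + \<beta> *\<^sub>R a \<in> K" if "x \<in> X" "a \<in> A" for x a
        using K(2) pos sum_1 that X(2) unfolding p_convex_def A_def T_def by blast
    qed
    moreover have "real (card X) * \<beta> ^ n * (measure ?L K / 2) \<le> real (card X) * \<beta> ^ n * measure ?L A"
      using A_half pos by (intro mult_left_mono) auto
    ultimately have "real (card X) * \<beta> ^ n * measure ?L K \<le> 2 * measure ?L K" by simp
    then have "real (card X) * \<beta> ^ n \<le> 2" using K_pos by simp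
    moreover have "exp (- real m) \<le> \<beta> ^ n"
      unfolding \<beta>_def u_def by (rule power_lower_bound[OF p lam m(3)])
    ultimately have "real (card X) * exp (- real m) \<le> 2"
      by (meson mult_left_mono of_nat_0_le_iff order_trans)
    then show "real (card X) \<le> 2 * exp (real m)"
      by (simp add: exp_minus field_simps)
  qed
  then obtain X where X: "X \<subseteq> T" "finite X" "real (card X) \<le> 2 * exp (real m)"
    and X_net: "\<And>y. y \<in> T \<Longrightarrow> \<exists>x\<in>X. f (y - x) \<le> r" by blast
  have "\<exists>E. subspace E \<and> E \<subseteq> Rn n \<and> dim E = d \<and>
      (\<forall>y\<in>E. \<forall>x\<in>X. R * sqrt (real m) < 256 * sqrt (real n) * f (y - x))"
    unfolding f_def
  proof (rule random_kernel_avoids[OF X(2) _ X(3) R_pos m(1,2)])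
    show "L2_set (\<lambda>k. \<Sum>i<n. w k i * x i) {..<n} = R" if "x \<in> X" for x
      using that X(1) by (auto simp: T_def f_def)
  qed
  then obtain E where E: "subspace E" "E \<subseteq> Rn n" "dim E = d"
    and avoid: "\<And>x y. y \<in> E \<Longrightarrow> x \<in> X \<Longrightarrow> R * sqrt (real m) < 256 * sqrt (real n) * f (y - x)"
    by blast
  have "f y < R" if y: "y \<in> E" "y \<in> K" for y
  proof (rule ccontr)
    assume "\<not> f y < R"
    then have fy: "R \<le> f y" by simp
    \<comment> \<open>Shrinking \<open>y\<close> onto the sphere \<open>f = R\<close> keeps it in
      \<open>E\<close> and in the star-shaped \<open>K\<close>.\<close>
    define t where "t = R / f y"
    have t: "0 < t" "t \<le> 1" using fy R_pos by (simp_all add: t_def)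
    have "t *\<^sub>R y \<in> K" using K(1) y(2) t unfolding body_def by force
    moreover have "f (t *\<^sub>R y) = R" using t fy R_pos by (simp add: scale) (simp add: t_def)
    ultimately obtain x where x: "x \<in> X" "f (t *\<^sub>R y - x) \<le> r"
      using X_net[of "t *\<^sub>R y"] by (auto simp: T_def)
    have "t *\<^sub>R y \<in> E" using y(1) by (intro subspace_scale[OF E(1)])
    from avoid[OF this x(1)] have "R * sqrt (real m) < 256 * sqrt (real n) * f (t *\<^sub>R y - x)" .
    also have "\<dots> \<le> 256 * sqrt (real n) * r" using x(2) by (intro mult_left_mono) auto
    finally have "R * sqrt (real m) < 256 * sqrt (real n) * r" .
    moreover have "256 * sqrt (real n) * r \<le> R * sqrt (real m)"
    proof -
      have "sqrt (1 - lam) * sqrt (real n) \<le> sqrt (real m)"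
        using m(3) by (simp flip: real_sqrt_mult)
      then have "256 * r * (sqrt (1 - lam) * sqrt (real n)) \<le> 256 * r * sqrt (real m)"
        using r by (intro mult_left_mono) auto
      then show ?thesis using lam by (simp add: R_eq field_simps)
    qed
    ultimately show False by simp
  qed
  then show ?thesis using E by blast
qed

theorem theorem3:
  shows "\<exists>C::real. C > 1 \<and>
    (\<forall>lam::real. 0 < lam \<and> lam < 1 \<longrightarrow>
      (\<exists>n0::nat. \<forall>n\<ge>n0. \<forall>(p::real) K N.
        0 < p \<and> p \<le> 1 \<and> body n K \<and> p_convex p K \<and> euclidean_norm_on_Rn n N \<longrightarrow>
        (\<exists>E. subspace E \<and> E \<subseteq> Rn n \<and> dim E = nat \<lfloor>lam * real n\<rfloor> \<and>
          (\<forall>x\<in>E. body_gauge K x \<ge>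
             (1 - lam) powr (1/2 + 1/p) / (a_const C p * mean_norm n N K) * N x))))"
proof -
  \<comment> \<open>\<open>C = exp 12\<close> and \<open>n0 = 1\<close> serve for all
    \<open>lam\<close>: \<open>n \<ge> 1\<close> gives \<open>\<lfloor>lam * n\<rfloor> < n\<close>,
    hence codimension at least 1.\<close>
  have main: "\<exists>E. subspace E \<and> E \<subseteq> Rn n \<and> dim E = nat \<lfloor>lam * real n\<rfloor> \<and>
          (\<forall>x\<in>E. body_gauge K x \<ge>
             (1 - lam) powr (1/2 + 1/p) / (a_const (exp 12) p * mean_norm n N K) * N x)"
    if lam: "0 < lam" "lam < 1" and n: "1 \<le> n" and p: "0 < p" "p \<le> 1"
      and K: "body n K" "p_convex p K" and N: "euclidean_norm_on_Rn n N"
    for lam p :: real and n K N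
  proof -
    define d where "d = nat \<lfloor>lam * real n\<rfloor>"
    have d_le: "real d \<le> lam * real n" using lam by (simp add: d_def)
    have "lam * real n < 1 * real n" using lam n by (intro mult_strict_right_mono) auto
    then have "d < n" using d_le by linarith
    define m where "m = n - d"
    have m: "1 \<le> m" "n = d + m" using \<open>d < n\<close> by (simp_all add: m_def)
    have "(1 - lam) * real n \<le> real m"
      using d_le \<open>d < n\<close> by (simp add: m_def of_nat_diff algebra_simps)
    note m = m this
    have K_Rn: "K \<subseteq> Rn n" using K(1) by (rule body_subset_Rn)
    obtain B where B: "inner_product_on_Rn n B" "\<And>x. x \<in> Rn n \<Longrightarrow> N x = sqrt (B x x)"
      using N by (auto simp: euclidean_norm_on_Rn_def)
    obtain w where w: "\<And>x. x \<in> Rn n \<Longrightarrow> B x x = (\<Sum>k<n. (\<Sum>i<n. w k i * x i)\<^sup>2)"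
      using inner_product_sum_of_squares[OF B(1)] by blast
    \<comment> \<open>\<open>N\<close> is specified on \<open>Rn n\<close> only. Its replacement
      \<open>f\<close> is a measurable seminorm everywhere, and the mean over \<open>K\<close> is
      unchanged since \<open>K\<close> lies in \<open>Rn n\<close>.\<close>
    define f where "f = (\<lambda>x. L2_set (\<lambda>k. \<Sum>i<n. w k i * x i) {..<n})"
    interpret seminorm f unfolding f_def by (rule seminorm_L2_set_linear)
    have N_eq: "N x = f x" if "x \<in> Rn n" for x
      using B(2)[OF that] w[OF that] by (simp add: f_def L2_set_def)
    have "indicator K x *\<^sub>R N x = indicator K x *\<^sub>R f x" for x
      using N_eq K_Rn by (cases "x \<in> K") auto
    then have mean_eq: "mean_norm n N K = mean_norm n f K"
      by (simp only: mean_norm_def set_lebesgue_integral_def)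
    have "mean_norm n f K \<ge> 0"
      unfolding mean_norm_def set_lebesgue_integral_def
      using nonneg by (intro mult_nonneg_nonneg integral_nonneg_AE always_eventually allI) simp_all
    then consider "mean_norm n f K = 0" | "mean_norm n f K > 0" by linarith
    then show ?thesis
    proof cases
      case 1
      \<comment> \<open>For mean 0 the quotient in the claim is 0, as a division by zero. Any
        subspace of dimension \<open>d\<close> then serves, the gauge being nonnegative.\<close>
      have "dim (Rn n) = d + m" by (simp add: dim_Rn m)
      then obtain E where E: "subspace E" "E \<subseteq> Rn n" "dim E = d"
        using exists_common_kernel[of "Rn n" d m "\<lambda>j x. 0"] subspace_Rn by auto
      have "0 \<le> body_gauge K x" if "x \<in> E" for x
        using E(2) that by (intro body_gauge_ge[OF K(1)]) auto
      then show ?thesis using E unfolding mean_eq 1 d_def by auto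
    next
      case 2
      define \<alpha> where "\<alpha> = (p * (1 - lam) / 4) powr (1 / p)"
      define R where "R = 1024 * mean_norm n f K / (\<alpha> * sqrt (1 - lam))"
      have \<alpha>: "\<alpha> > 0" using p lam by (simp add: \<alpha>_def)
      have R: "R > 0" using 2 \<alpha> lam by (simp add: R_def)
      have "\<exists>E. subspace E \<and> E \<subseteq> Rn n \<and> dim E = d \<and> (\<forall>y\<in>E. y \<in> K \<longrightarrow> f y < R)"
        unfolding f_def
        by (rule subspace_section_bounded[OF K p lam _ m]) (use 2 in \<open>simp_all only: R_def \<alpha>_def f_def\<close>)
      then obtain E where E: "subspace E" "E \<subseteq> Rn n" "dim E = d"
        and bounded_section: "\<And>y. y \<in> E \<Longrightarrow> y \<in> K \<Longrightarrow> f y < R" by blast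
      have "(1 - lam) powr (1/2 + 1/p) / (a_const (exp 12) p * mean_norm n N K) * N x \<le> body_gauge K x"
        if x: "x \<in> E" for x
      proof -
        have x_Rn: "x \<in> Rn n" using E(2) x by blast
        \<comment> \<open>The exponent splits: \<open>sqrt (1 - lam)\<close> comes from the ratio of
          \<open>m\<close> to \<open>n\<close> in \<open>R\<close>, and
          \<open>(1 - lam) powr (1 / p)\<close> from \<open>\<alpha>\<close>. The remaining factors
          of \<open>1 / R\<close> are absorbed by \<open>a_const\<close>.\<close>
        have "(1 - lam) powr (1/2 + 1/p) / (a_const (exp 12) p * mean_norm n N K) =
            sqrt (1 - lam) * (1 - lam) powr (1 / p) / mean_norm n f K * (1 / a_const (exp 12) p)"
          using lam by (simp add: powr_add powr_half_sqrt mean_eq)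
        also have "\<dots> \<le> sqrt (1 - lam) * (1 - lam) powr (1 / p) / mean_norm n f K * ((p / 4) powr (1 / p) / 1024)"
          using lam 2 by (intro mult_left_mono inverse_a_const_le[OF p]) auto
        also have "\<dots> = 1 / R"
        proof -
          have "\<alpha> = (p / 4) powr (1 / p) * (1 - lam) powr (1 / p)"
            using p lam by (simp add: \<alpha>_def flip: powr_mult)
          then show ?thesis by (simp add: R_def mult_ac)
        qed
        finally have "(1 - lam) powr (1/2 + 1/p) / (a_const (exp 12) p * mean_norm n N K) * N x \<le> 1 / R * f x"
          unfolding N_eq[OF x_Rn] using nonneg by (intro mult_right_mono)
        also have "1 / R * f x \<le> body_gauge K x"
        proof (rule body_gauge_ge[OF K(1) x_Rn])
          fix s y assume s: "s > 0" "y \<in> K" "x = s *\<^sub>R y"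
          \<comment> \<open>As \<open>y\<close> lies in \<open>E\<close> and in \<open>K\<close>,
            homogeneity gives \<open>f x = s * f y < s * R\<close>.\<close>
          have "y = (1 / s) *\<^sub>R x" using s by simp
          then have "y \<in> E" using subspace_scale[OF E(1) x] by blast
          then have "f y < R" using bounded_section s(2) by blast
          then show "1 / R * f x \<le> s" using s R by (simp add: scale field_simps)
        qed
        finally show ?thesis .
      qed
      then show ?thesis using E unfolding d_def by blast
    qed
  qed
  show ?thesis
  proof (intro exI[of _ "exp 12"] conjI allI impI)
    show "(1::real) < exp 12" by simp
    fix lam :: real assume "0 < lam \<and> lam < 1"
    then show "\<exists>n0::nat. \<forall>n\<ge>n0. \<forall>(p::real) K N.
        0 < p \<and> p \<le> 1 \<and> body n K \<and> p_convex p K \<and> euclidean_norm_on_Rn n N \<longrightarrow>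
        (\<exists>E. subspace E \<and> E \<subseteq> Rn n \<and> dim E = nat \<lfloor>lam * real n\<rfloor> \<and>
          (\<forall>x\<in>E. body_gauge K x \<ge>
             (1 - lam) powr (1/2 + 1/p) / (a_const (exp 12) p * mean_norm n N K) * N x))"
      by (intro exI[of _ 1] allI impI main) auto
  qed
qed

end
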